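(* Let $(M^3,T,d)$ be a closed three-dimensional piecewise flat metrized manifold and let $f(t)$ be a conformal variation of it, with extension $\mathcal{C}$; let $d_{ij}=d_{ij}(t)$ and $K_i=K_i(t)$ be the metric $\mathcal{C}[f(t)]$ and its scalar curvature. Then at $t=0$, for every vertex $i$, $$\frac{dK_i}{dt}=-2\sum_{j\neq i}\frac{\ell_{ij}^*}{\ell_{ij}}\left(\frac{df_j}{dt}-\frac{df_i}{dt}\right)+\sum_{j\ne i}\left(2\pi-\sum_{k,\ell}\beta_{ij,k\ell}\right)\frac{d}{dt}d_{ij}$$ $$=-\sum_{j\ne i}\left(2\frac{\ell_{ij}^*}{\ell_{ij}}-\frac{q_{ij}}{\ell_{ij}}K_{ij}\right)\left(\frac{df_j}{dt}-\frac{df_i}{dt}\right)+K_i\frac{df_i}{dt},$$ where $q_{ij}=\dfrac{\partial d_{ij}}{\partial f_j}=\dfrac{\partial d_{ji}}{\partial f_i}$, the sums over $j$ are over all $j$ with $\{i,j\}\in E(T)$, and the sum over $k,\ell$ is over all tetrahedra $\{i,j,k,\ell\}$ containing $\{i,j\}$, each counted once.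
   Context: A triangulated manifold $(M,T)$ is a topological manifold with a triangulation $T$ (here finite, and simplices are determined by their vertices and written $\{i,j,\dots,k\}$). $V(T)$, $E(T)$, $E_+(T)$ are the sets of vertices, edges, and directed edges (each edge $\{i,j\}$ gives two directed edges $(i,j)$ and $(j,i)$); $X^*$ is the vector space of functions $X\to\mathbb{R}$. $(M,T,\ell)$, with $\ell\in E(T)^*$, is piecewise flat if every simplex can be realized as a nondegenerate Euclidean simplex with edge lengths given by $\ell$. A (piecewise flat) metric is $d\in E_+(T)^*$ such that with $\ell_{ij}=d_{ij}+d_{ji}$, $(M,T,\ell)$ is piecewise flat, and for every triangle $\{i,j,k\}$: $d_{ij}^2+d_{jk}^2+d_{ki}^2=d_{ji}^2+d_{ik}^2+d_{kj}^2$. (The $d_{ij}$ may be negative.) Then $(M,T,d)$ is a piecewise flat metrized manifold; $\mathfrak{met}(M,T)$ is the set of all metrics $d$. A conformal structure on an open set $U\subset V(T)^*$ is a smooth map $\mathcal{C}:U\to\mathfrak{met}(M,T)\subset E_+(T)^*$ such that, writing $d=\mathcal{C}[f]$ and $\ell_{ij}=d_{ij}+d_{ji}$, for each $(i,j)\in E_+(T)$ and $k\in V(T)$: $\partial\ell_{ij}/\partial f_i=d_{ij}$, and $\partial d_{ij}/\partial f_k=0$ if $k\ne i$ and $k\neq j$. A conformal variation of $(M,T,d)$ is a smooth curve $f:(-\varepsilon,\varepsilon)\to V(T)^*$ for which there is a conformal structure $\mathcal{C}:U\to\mathfrak{met}(M,T)$ with $f((-\varepsilon,\varepsilon))\subset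 U$ and $\mathcal{C}[f(0)]=d$; such $\mathcal{C}$ is called an extension of the variation. All quantities for a conformal variation are evaluated at $t=0$. $\gamma_{i,jk}$ is the angle at vertex $i$ in triangle $\{i,j,k\}$; $\beta_{ij,k\ell}$ is the dihedral angle at edge $\{i,j\}$ in tetrahedron $\{i,j,k,\ell\}$. Define $$h_{ij,k}=\frac{d_{ik}-d_{ij}\cos\gamma_{i,jk}}{\sin\gamma_{i,jk}},\qquad h_{ijk,\ell}=\frac{h_{ij,\ell}-h_{ij,k}\cos\beta_{ij,k\ell}}{\sin\beta_{ij,k\ell}},\qquad A_{ij,k\ell}=\tfrac12\left(h_{ij,k}h_{ijk,\ell}+h_{ij,\ell}h_{ij\ell,k}\right).$$ The dual length is $\ell_{ij}^*=\sum A_{ij,k\ell}$, the sum over all tetrahedra $\{i,j,k,\ell\}$ containing $\{i,j\}$, each counted once. The edge curvature is $K_{ij}=\left(2\pi-\sum\beta_{ij,k\ell}\right)\ell_{ij}$ and the scalar curvature at vertex $i$ is $K_i=\sum_{j}\left(2\pi-\sum\beta_{ij,k\ell}\right)d_{ij}$, where the outer sum is over edges $\{i,j\}$ containing $i$ and the inner sums are over all tetrahedra $\{i,j,k,\ell\}$ containing $\{i,j\}$. *)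

theory Defs
  imports "HOL-Analysis.Analysis"
begin

section \<open>Triangulated manifolds\<close>

definition topological_manifold :: "nat \<Rightarrow> 'm topology \<Rightarrow> bool" where
  "topological_manifold n M \<longleftrightarrow>
     Hausdorff_space M \<and> second_countable M \<and>
     (\<forall>x\<in>topspace M. \<exists>U W. openin M U \<and> x \<in> U \<and> openin (Euclidean_space n) W \<and>
        subtopology M U homeomorphic_space subtopology (Euclidean_space n) W)"

text \<open>Manifolds here have no boundary, so a closed manifold is a compact one.\<close>

definition closed_manifold :: "nat \<Rightarrow> 'm topology \<Rightarrow> bool" where
  "closed_manifold n M \<longleftrightarrow> topological_manifold n M \<and> compact_space M"

text \<open>
  A simplex is the nonempty set of its vertices. The vertex set is the whole finite type \<open>'v\<close>,
  so that \<open>real ^ 'v\<close> is the space of real functions on the vertices.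
\<close>

definition simplicial_complex :: "'v::finite set set \<Rightarrow> bool" where
  "simplicial_complex T \<longleftrightarrow>
     {} \<notin> T \<and> (\<forall>v. {v} \<in> T) \<and> (\<forall>\<sigma>\<in>T. \<forall>\<tau>. \<tau> \<noteq> {} \<and> \<tau> \<subseteq> \<sigma> \<longrightarrow> \<tau> \<in> T)"

text \<open>The geometric realization, in barycentric coordinates.\<close>

definition polyhedron_of :: "'v::finite set set \<Rightarrow> (real ^ 'v) set" where
  "polyhedron_of T =
     {x. (\<forall>v. 0 \<le> x $ v) \<and> (\<Sum>v\<in>UNIV. x $ v) = 1 \<and> {v. x $ v \<noteq> 0} \<in> T}"

definition triangulates :: "'v::finite set set \<Rightarrow> 'm topology \<Rightarrow> bool" where
  "triangulates T M \<longleftrightarrow>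
     simplicial_complex T \<and> top_of_set (polyhedron_of T) homeomorphic_space M"

definition edge :: "'v set set \<Rightarrow> 'v \<Rightarrow> 'v \<Rightarrow> bool" where
  "edge T i j \<longleftrightarrow> i \<noteq> j \<and> {i, j} \<in> T"

definition triangle :: "'v set set \<Rightarrow> 'v \<Rightarrow> 'v \<Rightarrow> 'v \<Rightarrow> bool" where
  "triangle T i j k \<longleftrightarrow> distinct [i, j, k] \<and> {i, j, k} \<in> T"

definition tetrahedron :: "'v set set \<Rightarrow> 'v \<Rightarrow> 'v \<Rightarrow> 'v \<Rightarrow> 'v \<Rightarrow> bool" where
  "tetrahedron T i j k l \<longleftrightarrow> distinct [i, j, k, l] \<and> {i, j, k, l} \<in> T"

text \<open>
  Sum over the tetrahedra \<open>{i, j, k, l}\<close> containing \<open>{i, j}\<close>, each counted once. A tetrahedron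
  arises from the two pairs \<open>(k, l)\<close> and \<open>(l, k)\<close>, whence the factor 1/2; the summands to which
  this is applied are symmetric in \<open>k\<close> and \<open>l\<close>.
\<close>

definition tetra_sum :: "'v::finite set set \<Rightarrow> 'v \<Rightarrow> 'v \<Rightarrow> ('v \<Rightarrow> 'v \<Rightarrow> real) \<Rightarrow> real" where
  "tetra_sum T i j F = (1/2) * (\<Sum>(k, l) | tetrahedron T i j k l. F k l)"


section \<open>Piecewise flat metrics\<close>

text \<open>
  Functions on directed edges are represented by functions on pairs of vertices, of which only
  the values on directed edges matter.
\<close>

type_synonym 'v edge_fun = "'v \<Rightarrow> 'v \<Rightarrow> real"

definition len :: "'v edge_fun \<Rightarrow> 'v edge_fun" where
  "len d i j = d i j + d j i"

text \<open>
  Every Euclidean simplex with vertices labelled in \<open>'v\<close> has dimension less than \<open>CARD('v)\<close> and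
  therefore embeds isometrically in \<open>real ^ 'v\<close>, which serves as ambient Euclidean space.
\<close>

definition realizes :: "'v edge_fun \<Rightarrow> 'v set \<Rightarrow> ('v \<Rightarrow> real ^ 'v::finite) \<Rightarrow> bool" where
  "realizes L \<sigma> p \<longleftrightarrow>
     inj_on p \<sigma> \<and> \<not> affine_dependent (p ` \<sigma>) \<and>
     (\<forall>i\<in>\<sigma>. \<forall>j\<in>\<sigma>. i \<noteq> j \<longrightarrow> dist (p i) (p j) = L i j)"

definition piecewise_flat :: "'v::finite set set \<Rightarrow> 'v edge_fun \<Rightarrow> bool" where
  "piecewise_flat T L \<longleftrightarrow> (\<forall>\<sigma>\<in>T. \<exists>p. realizes L \<sigma> p)"

definition met :: "'v::finite set set \<Rightarrow> 'v edge_fun set" where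
  "met T = {d. piecewise_flat T (len d) \<and>
     (\<forall>i j k. triangle T i j k \<longrightarrow>
        (d i j)\<^sup>2 + (d j k)\<^sup>2 + (d k i)\<^sup>2 = (d j i)\<^sup>2 + (d i k)\<^sup>2 + (d k j)\<^sup>2)}"


section \<open>Angles, dual lengths and curvature\<close>

definition vec_angle :: "'a::real_inner \<Rightarrow> 'a \<Rightarrow> real" where
  "vec_angle u v = arccos (u \<bullet> v / (norm u * norm v))"

definition perp_part :: "'a::real_inner \<Rightarrow> 'a \<Rightarrow> 'a" where
  "perp_part u v = v - (v \<bullet> u / (u \<bullet> u)) *\<^sub>R u"

text \<open>
  The choice of realization is immaterial: it is unique up to an isometry.
  \<open>face_angle d i j k\<close> is the angle at \<open>i\<close> in the triangle \<open>{i, j, k}\<close>, and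
  \<open>dihedral d i j k l\<close> the dihedral angle at the edge \<open>{i, j}\<close> in the tetrahedron \<open>{i, j, k, l}\<close>.
\<close>

definition face_angle :: "'v::finite edge_fun \<Rightarrow> 'v \<Rightarrow> 'v \<Rightarrow> 'v \<Rightarrow> real" where
  "face_angle d i j k =
     (let p = (SOME p. realizes (len d) {i, j, k} p)
      in vec_angle (p j - p i) (p k - p i))"

definition dihedral :: "'v::finite edge_fun \<Rightarrow> 'v \<Rightarrow> 'v \<Rightarrow> 'v \<Rightarrow> 'v \<Rightarrow> real" where
  "dihedral d i j k l =
     (let p = (SOME p. realizes (len d) {i, j, k, l} p)
      in vec_angle (perp_part (p j - p i) (p k - p i)) (perp_part (p j - p i) (p l - p i)))"

text \<open>Signed heights \<open>h\<^bsub>ij,k\<^esub>\<close> and \<open>h\<^bsub>ijk,l\<^esub>\<close>.\<close>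

definition height2 :: "'v::finite edge_fun \<Rightarrow> 'v \<Rightarrow> 'v \<Rightarrow> 'v \<Rightarrow> real" where
  "height2 d i j k =
     (d i k - d i j * cos (face_angle d i j k)) / sin (face_angle d i j k)"

definition height3 :: "'v::finite edge_fun \<Rightarrow> 'v \<Rightarrow> 'v \<Rightarrow> 'v \<Rightarrow> 'v \<Rightarrow> real" where
  "height3 d i j k l =
     (height2 d i j l - height2 d i j k * cos (dihedral d i j k l)) / sin (dihedral d i j k l)"

definition dual_area :: "'v::finite edge_fun \<Rightarrow> 'v \<Rightarrow> 'v \<Rightarrow> 'v \<Rightarrow> 'v \<Rightarrow> real" where
  "dual_area d i j k l =
     (1/2) * (height2 d i j k * height3 d i j k l + height2 d i j l * height3 d i j l k)"

definition dual_length :: "'v::finite set set \<Rightarrow> 'v edge_fun \<Rightarrow> 'v \<Rightarrow> 'v \<Rightarrow> real" where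
  "dual_length T d i j = tetra_sum T i j (\<lambda>k l. dual_area d i j k l)"

definition edge_curvature :: "'v::finite set set \<Rightarrow> 'v edge_fun \<Rightarrow> 'v \<Rightarrow> 'v \<Rightarrow> real" where
  "edge_curvature T d i j =
     (2 * pi - tetra_sum T i j (\<lambda>k l. dihedral d i j k l)) * len d i j"

definition scalar_curvature :: "'v::finite set set \<Rightarrow> 'v edge_fun \<Rightarrow> 'v \<Rightarrow> real" where
  "scalar_curvature T d i =
     (\<Sum>j | edge T i j. (2 * pi - tetra_sum T i j (\<lambda>k l. dihedral d i j k l)) * d i j)"


section \<open>Conformal structures and conformal variations\<close>

text \<open>Continuous differentiability of order \<open>n\<close>, for open \<open>S\<close>.\<close>

fun Ck_on :: "nat \<Rightarrow> 'a::real_normed_vector set \<Rightarrow> ('a \<Rightarrow> 'b::real_normed_vector) \<Rightarrow> bool" where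
  "Ck_on 0 S g \<longleftrightarrow> continuous_on S g"
| "Ck_on (Suc n) S g \<longleftrightarrow>
     (\<forall>x\<in>S. g differentiable (at x)) \<and> (\<forall>v. Ck_on n S (\<lambda>x. frechet_derivative g (at x) v))"

definition smooth_on :: "'a::real_normed_vector set \<Rightarrow> ('a \<Rightarrow> 'b::real_normed_vector) \<Rightarrow> bool" where
  "smooth_on S g \<longleftrightarrow> (\<forall>n. Ck_on n S g)"

definition partial :: "'v::finite \<Rightarrow> (real ^ 'v \<Rightarrow> real) \<Rightarrow> real ^ 'v \<Rightarrow> real" where
  "partial k g x = deriv (\<lambda>s. g (x + s *\<^sub>R axis k 1)) 0"

definition conformal_structure ::
  "'v::finite set set \<Rightarrow> (real ^ 'v) set \<Rightarrow> (real ^ 'v \<Rightarrow> 'v edge_fun) \<Rightarrow> bool" where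
  "conformal_structure T U C \<longleftrightarrow>
     open U \<and> (\<forall>x\<in>U. C x \<in> met T) \<and>
     (\<forall>i j. edge T i j \<longrightarrow>
        smooth_on U (\<lambda>x. C x i j) \<and>
        (\<forall>x\<in>U. partial i (\<lambda>y. len (C y) i j) x = C x i j \<and>
           (\<forall>k. k \<noteq> i \<and> k \<noteq> j \<longrightarrow> partial k (\<lambda>y. C y i j) x = 0)))"

definition extends_variation ::
  "'v::finite set set \<Rightarrow> 'v edge_fun \<Rightarrow> real \<Rightarrow> (real \<Rightarrow> real ^ 'v) \<Rightarrow>
   (real ^ 'v) set \<Rightarrow> (real ^ 'v \<Rightarrow> 'v edge_fun) \<Rightarrow> bool" where
  "extends_variation T d \<epsilon> f U C \<longleftrightarrow>
     conformal_structure T U C \<and> f ` {-\<epsilon><..<\<epsilon>} \<subseteq> U \<and>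
     (\<forall>i j. edge T i j \<longrightarrow> C (f 0) i j = d i j)"

definition conformal_variation ::
  "'v::finite set set \<Rightarrow> 'v edge_fun \<Rightarrow> real \<Rightarrow> (real \<Rightarrow> real ^ 'v) \<Rightarrow> bool" where
  "conformal_variation T d \<epsilon> f \<longleftrightarrow>
     0 < \<epsilon> \<and> smooth_on {-\<epsilon><..<\<epsilon>} f \<and> (\<exists>U C. extends_variation T d \<epsilon> f U C)"

end

theory Submission
  imports Defs
begin

text \<open>
  The scalar curvature at \<open>i\<close> is a sum over edges, so its derivative has one part from the
  derivatives of the \<open>d\<^bsub>ij\<^esub>\<close> and one from the derivatives of the dihedral angles. The second part is
  a sum over the tetrahedra at \<open>i\<close>, and the theorem comes down to one identity in a single Euclidean
  tetrahedron \<open>i, j, k, l\<close> (\<open>tetra_variation\<close>):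
  \<open>d\<^bsub>ij\<^esub> \<beta>\<^bsub>ij\<^esub>' + d\<^bsub>ik\<^esub> \<beta>\<^bsub>ik\<^esub>' + d\<^bsub>il\<^esub> \<beta>\<^bsub>il\<^esub>' = 2 \<Sum>\<^sub>m A\<^bsub>im\<^esub> / \<ell>\<^bsub>im\<^esub> (f\<^sub>m' - f\<^sub>i')\<close>, with \<open>m\<close> ranging over \<open>j, k, l\<close>.

  The reason for this identity is geometric. The metric condition on the triangles says that the
  tetrahedron with vertices \<open>p\<^sub>i\<close> has a center \<open>c\<close> with \<open>(c - p\<^sub>i) \<bullet> (p\<^sub>j - p\<^sub>i) = d\<^bsub>ij\<^esub> \<ell>\<^bsub>ij\<^esub>\<close> for every edge:
  the \<open>d\<^bsub>ij\<^esub>\<close> are the signed distances from the vertices to the feet of the perpendiculars from \<open>c\<close> to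
  the edges. The equation \<open>\<ell>\<^bsub>ij\<^esub>' = d\<^bsub>ij\<^esub> f\<^sub>i' + d\<^bsub>ji\<^esub> f\<^sub>j'\<close> then says that, up to isometries, a conformal
  variation moves each vertex radially, with velocity \<open>f\<^sub>i' (p\<^sub>i - c)\<close>. If only \<open>p\<^sub>j\<close> moves, then the face
  \<open>i, j, k\<close> turns about the edge \<open>i, k\<close>, with a speed proportional to the signed distance from \<open>c\<close> to
  that face. This distance is \<open>h\<^bsub>ijk,l\<^esub>\<close>, and so the changes of the three angles at \<open>i\<close>, weighted with
  \<open>d\<^bsub>ij\<^esub>, d\<^bsub>ik\<^esub>, d\<^bsub>il\<^esub>\<close>, add up to the products \<open>h\<^bsub>ij,k\<^esub> h\<^bsub>ijk,l\<^esub>\<close> that make up the area \<open>A\<^bsub>ij,kl\<^esub>\<close>.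

  The formal proof carries this out with the Gram matrix of the three edge vectors at \<open>i\<close>, whose entries
  are polynomials in the edge lengths, and with the coordinates \<open>\<alpha>, \<beta>, \<gamma>\<close> of \<open>c - p\<^sub>i\<close> in these vectors.
  In these terms \<open>h\<^bsub>ijk,l\<^esub>\<close> is a multiple of \<open>\<gamma>\<close> (\<open>height3_eq\<close>), the derivative of a dihedral angle is a
  combination of \<open>\<beta>\<close> and \<open>\<gamma>\<close> (\<open>dihedral_variation\<close>), and the identity follows by adding up.

  Two further points lead to the theorem. The sum over the tetrahedra at all edges at \<open>i\<close> is a sum over
  ordered triples \<open>(j, k, l)\<close>, so it is determined by the sums of its terms over the cyclic permutations
  of \<open>j, k, l\<close>, and the identity is about these (\<open>sum_tetra_sum_cyclic\<close>). And
  \<open>\<partial>\<ell>\<^bsub>ij\<^esub>/\<partial>f\<^sub>i = d\<^bsub>ij\<^esub>\<close> makes \<open>\<partial>d\<^bsub>ij\<^esub>/\<partial>f\<^sub>j\<close> and \<open>\<partial>d\<^bsub>ji\<^esub>/\<partial>f\<^sub>i\<close> the two mixed second derivatives of \<open>\<ell>\<^bsub>ij\<^esub>\<close>. They agree, with common value \<open>q\<^bsub>ij\<^esub>\<close>, so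
  \<open>d\<^bsub>ij\<^esub>' = d\<^bsub>ij\<^esub> f\<^sub>i' + q\<^bsub>ij\<^esub> (f\<^sub>j' - f\<^sub>i')\<close> (\<open>conformal_derivatives\<close>), and this turns the first formula into
  the second.
\<close>

section \<open>Identities for Gram matrices\<close>

text \<open>
  Here \<open>A, B, E\<close> and \<open>x, y, z\<close> are the diagonal and off-diagonal entries of the Gram matrix of three
  vectors \<open>v\<^sub>1, v\<^sub>2, v\<^sub>3\<close>, and \<open>P, Q, R\<close> are the inner products of these vectors with
  \<open>c = \<alpha> v\<^sub>1 + \<beta> v\<^sub>2 + \<gamma> v\<^sub>3\<close>. Primes denote derivatives when the origin moves with velocity \<open>- \<phi> c\<close> and
  the endpoint of \<open>v\<^sub>m\<close> with velocity \<open>(\<phi> + r\<^sub>m) (v\<^sub>m - c)\<close>, where \<open>r\<^sub>1, r\<^sub>2, r\<^sub>3\<close> are \<open>a, b, e\<close>. The left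
  side is the numerator of the derivative of the cosine \<open>u / sqrt (F1 * F2)\<close> of the dihedral angle at
  \<open>v\<^sub>1\<close>; the scaling \<open>\<phi>\<close> cancels, and the face of \<open>v\<^sub>1, v\<^sub>2\<close> turns in proportion to the third coordinate
  \<open>\<gamma>\<close> of \<open>c\<close>.
\<close>

lemma dihedral_variation_algebra:
  fixes A B E x y z :: real
  assumes P: "P = \<alpha> * A + \<beta> * x + \<gamma> * y" and Q: "Q = \<alpha> * x + \<beta> * B + \<gamma> * z" and R: "R = \<alpha> * y + \<beta> * z + \<gamma> * E"
  and F1: "F1 = A * B - x^2" and F2: "F2 = A * E - y^2" and u: "u = A * z - x * y"
  and F1': "F1' = (2*\<phi>*A + 2*a*(A-P)) * B + A * (2*\<phi>*B + 2*b*(B-Q)) - 2*x*(2*\<phi>*x+a*(x-Q)+b*(x-P))"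
  and F2': "F2' = (2*\<phi>*A + 2*a*(A-P)) * E + A * (2*\<phi>*E + 2*e*(E-R)) - 2*y*(2*\<phi>*y+a*(y-R)+e*(y-P))"
  and u': "u' = (2*\<phi>*A + 2*a*(A-P)) * z + A * (2*\<phi>*z+b*(z-R)+e*(z-Q)) - ((2*\<phi>*x+a*(x-Q)+b*(x-P)) * y + x * (2*\<phi>*y+a*(y-R)+e*(y-P)))"
  and D: "D = A*B*E + 2*x*y*z - A*z^2 - B*y^2 - E*x^2"
  and "F1 \<noteq> 0" "F2 \<noteq> 0"
  shows "u' - u/2 * (F1'/F1 + F2'/F2) = - D * ((b * A - a * x) * \<gamma>/F1 + (e * A - a * y) * \<beta>/F2)"
proof -
  have *: "2 * F1 * F2 * u' - u * (F1' * F2 + F2' * F1) = - 2 * D * ((b * A - a * x) * \<gamma> * F2 + (e * A - a * y) * \<beta> * F1)"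
    unfolding assms(1-10) by algebra
  have "u' - u/2 * (F1'/F1 + F2'/F2) = (2 * F1 * F2 * u' - u * (F1' * F2 + F2' * F1)) / (2 * F1 * F2)"
    using assms(11,12) by (simp add: field_simps)
  also have "\<dots> = - D * ((b * A - a * x) * \<gamma>/F1 + (e * A - a * y) * \<beta>/F2)"
    unfolding * using assms(11,12) by (simp add: field_simps)
  finally show ?thesis .
qed

lemma cos_sin_arccos_quotient:
  fixes c s n :: real
  assumes "c\<^sup>2 + s = n\<^sup>2" "0 \<le> s" "0 < n"
  shows "cos (arccos (c / n)) = c / n" "sin (arccos (c / n)) = sqrt s / n"
proof -
  have "\<bar>c\<bar>\<^sup>2 \<le> n\<^sup>2" using assms(1,2) by (simp only: power2_abs)
  then have "\<bar>c\<bar> \<le> n" using assms(3) by (intro power2_le_imp_le[of "\<bar>c\<bar>" n]) simp_all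
  then have b: "\<bar>c / n\<bar> \<le> 1" using assms(3) by simp
  show "cos (arccos (c / n)) = c / n" using b by (rule cos_arccos_abs)
  have s: "s = n\<^sup>2 - c\<^sup>2" using assms(1) by simp
  have q: "1 - (c/n)\<^sup>2 = s / n\<^sup>2" unfolding s using assms(3) by (simp add: power_divide diff_divide_distrib)
  show "sin (arccos (c / n)) = sqrt s / n"
    unfolding sin_arccos_abs[OF b] q using assms(3) by (simp add: real_sqrt_divide)
qed

lemma DERIV_arccos_quotient:
  fixes u F G :: "real \<Rightarrow> real"
  assumes u: "(u has_real_derivative u') (at t)"
    and F: "(F has_real_derivative F') (at t)" and G: "(G has_real_derivative G') (at t)"
    and pos: "0 < F t" "0 < G t" and W: "W = F t * G t - (u t)\<^sup>2" "0 < W"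
  shows "((\<lambda>s. arccos (u s / sqrt (F s * G s))) has_real_derivative
           - (u' - u t / 2 * (F' / F t + G' / G t)) / sqrt W) (at t)"
proof -
  define n where "n = sqrt (F t * G t)"
  have n: "0 < n" "n\<^sup>2 = F t * G t" using pos by (auto simp: n_def)
  have sum: "(u t)\<^sup>2 + W = n\<^sup>2" using W n by simp
  have c: "(u t / n)\<^sup>2 < 1" using sum W(2) n(1) by (simp add: field_simps)
  then have "\<bar>u t / n\<bar> < 1" by (simp only: abs_square_less_1)
  then have b: "-1 < u t / n" "u t / n < 1" by (simp_all only: abs_less_iff minus_less_iff)
  have root: "sqrt (1 - (u t / n)\<^sup>2) = sqrt W / n"
  proof -
    have "1 - (u t / n)\<^sup>2 = W / n\<^sup>2" using sum n(1) by (simp add: field_simps)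
    then show ?thesis using n(1) by (simp add: real_sqrt_divide)
  qed
  have q: "((\<lambda>s. u s / sqrt (F s * G s)) has_real_derivative
      (u' - u t / 2 * (F' / F t + G' / G t)) / n) (at t)"
  proof -
    have "((\<lambda>s. u s / sqrt (F s * G s)) has_real_derivative
      (u' * n - u t * ((F' * G t + G' * F t) * (inverse n / 2))) / (n * n)) (at t)"
      using mult_pos_pos[OF pos] n(1) unfolding n_def
      by (auto intro!: derivative_eq_intros u F G)
    also have "(u' * n - u t * ((F' * G t + G' * F t) * (inverse n / 2))) / (n * n)
       = (u' - u t / 2 * ((F' * G t + G' * F t) / n\<^sup>2)) / n"
      using n(1) by (simp add: field_simps power2_eq_square)
    also have "(F' * G t + G' * F t) / n\<^sup>2 = F' / F t + G' / G t"
      using pos unfolding n(2) by (simp add: field_simps)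
    finally show ?thesis .
  qed
  have "((\<lambda>s. arccos (u s / sqrt (F s * G s))) has_real_derivative
       (inverse (- sqrt (1 - (u t / n)\<^sup>2))) * ((u' - u t / 2 * (F' / F t + G' / G t)) / n)) (at t)"
    using DERIV_chain2[OF DERIV_arccos q, folded n_def] b by simp
  also have "(inverse (- sqrt (1 - (u t / n)\<^sup>2))) * ((u' - u t / 2 * (F' / F t + G' / G t)) / n)
     = - (u' - u t / 2 * (F' / F t + G' / G t)) / sqrt W"
    unfolding root using n(1) W(2) by (simp add: field_simps)
  finally show ?thesis .
qed

text \<open>
  The Gram determinant is, up to the factor \<open>a \<bullet> a\<close>, the squared norm of the part of \<open>b\<close> orthogonal
  to \<open>a\<close>.
\<close>

lemma gram2_pos:
  fixes a b :: "'a::real_inner"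
  assumes "a \<noteq> 0" "\<And>s. b \<noteq> s *\<^sub>R a"
  shows "0 < (a \<bullet> a) * (b \<bullet> b) - (a \<bullet> b)\<^sup>2"
proof -
  define w where "w = (a \<bullet> a) *\<^sub>R b - (a \<bullet> b) *\<^sub>R a"
  have "w \<noteq> 0"
  proof
    assume "w = 0"
    moreover have "b = inverse (a \<bullet> a) *\<^sub>R w + ((a \<bullet> b) / (a \<bullet> a)) *\<^sub>R a"
      using assms(1) by (simp add: w_def scaleR_diff_right divide_inverse_commute)
    ultimately have "b = ((a \<bullet> b) / (a \<bullet> a)) *\<^sub>R a" by simp
    with assms(2) show False by blast
  qed
  then have "0 < w \<bullet> w" by simp
  also have "w \<bullet> w = (a \<bullet> a) * ((a \<bullet> a) * (b \<bullet> b) - (a \<bullet> b)\<^sup>2)"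
    by (simp add: w_def inner_diff inner_commute[of b a] power2_eq_square algebra_simps)
  finally show ?thesis by (rule zero_less_mult_pos) (use assms(1) in simp)
qed

text \<open>
  As above, with the vector \<open>w\<close> of cofactors, which is \<open>F\<close> times the part of \<open>e\<close> orthogonal to \<open>a\<close>
  and \<open>b\<close>; its squared norm is \<open>F\<close> times the determinant.
\<close>

lemma gram3_pos:
  fixes a b e :: "'a::real_inner"
  assumes "a \<noteq> 0" "\<And>s. b \<noteq> s *\<^sub>R a" "\<And>s t. e \<noteq> s *\<^sub>R a + t *\<^sub>R b"
  shows "0 < (a \<bullet> a) * (b \<bullet> b) * (e \<bullet> e) + 2 * (a \<bullet> b) * (a \<bullet> e) * (b \<bullet> e)
             - (a \<bullet> a) * (b \<bullet> e)\<^sup>2 - (b \<bullet> b) * (a \<bullet> e)\<^sup>2 - (e \<bullet> e) * (a \<bullet> b)\<^sup>2" (is "0 < ?D")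
proof -
  define F where "F = (a \<bullet> a) * (b \<bullet> b) - (a \<bullet> b)\<^sup>2"
  have F: "0 < F" unfolding F_def by (rule gram2_pos[OF assms(1,2)])
  define s where "s = (a \<bullet> b) * (b \<bullet> e) - (a \<bullet> e) * (b \<bullet> b)"
  define t where "t = (a \<bullet> b) * (a \<bullet> e) - (a \<bullet> a) * (b \<bullet> e)"
  define w where "w = F *\<^sub>R e + s *\<^sub>R a + t *\<^sub>R b"
  have "w \<noteq> 0"
  proof
    assume "w = 0"
    moreover have "e = inverse F *\<^sub>R w + (- s / F) *\<^sub>R a + (- t / F) *\<^sub>R b"
      using F by (simp add: w_def scaleR_add_right divide_inverse_commute)
    ultimately have "e = (- s / F) *\<^sub>R a + (- t / F) *\<^sub>R b" by simp
    with assms(3) show False by blast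
  qed
  then have "0 < w \<bullet> w" by simp
  also have "w \<bullet> w = F * ?D"
    unfolding w_def s_def t_def F_def inner_add_left inner_add_right inner_scaleR_left inner_scaleR_right
      inner_commute[of b a] inner_commute[of e a] inner_commute[of e b]
    by algebra
  finally show ?thesis using F by (rule zero_less_mult_pos)
qed

lemma perp_part_inner:
  fixes a b e :: "'a::real_inner"
  assumes "a \<noteq> 0"
  shows "perp_part a b \<bullet> perp_part a e = ((a \<bullet> a) * (b \<bullet> e) - (a \<bullet> b) * (a \<bullet> e)) / (a \<bullet> a)"
proof -
  have "a \<bullet> a \<noteq> 0" using assms by simp
  moreover have "m - r / q * n - n / q * (r - r / q * q) = (q * m - r * n) / q" if "q \<noteq> 0" for q m n r :: real
    using that by (simp add: field_simps)
  ultimately show ?thesis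
    by (simp only: perp_part_def inner_diff_left inner_diff_right inner_scaleR_left inner_scaleR_right
        inner_commute[of b a] inner_commute[of e a])
qed

lemma vec_angle_perp_part:
  fixes a b e :: "'a::real_inner"
  assumes "a \<noteq> 0"
  shows "vec_angle (perp_part a b) (perp_part a e) =
    arccos (((a \<bullet> a) * (b \<bullet> e) - (a \<bullet> b) * (a \<bullet> e)) /
            sqrt (((a \<bullet> a) * (b \<bullet> b) - (a \<bullet> b)\<^sup>2) * ((a \<bullet> a) * (e \<bullet> e) - (a \<bullet> e)\<^sup>2)))"
proof -
  have "(X / q) / (sqrt (Y / q) * sqrt (Z / q)) = X / sqrt (Y * Z)" if "0 < q" for X Y Z q :: real
  proof -
    have "sqrt (Y / q) * sqrt (Z / q) = sqrt (Y * Z) / q"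
      using that by (simp add: real_sqrt_divide real_sqrt_mult)
    then show ?thesis using that by simp
  qed
  moreover have "0 < a \<bullet> a" using assms by simp
  ultimately show ?thesis
    by (simp only: vec_angle_def norm_eq_sqrt_inner perp_part_inner[OF assms] power2_eq_square)
qed

section \<open>Gram matrices of Euclidean tetrahedra\<close>

text \<open>
  By the law of cosines, \<open>edge_inner d i j k\<close> is the inner product of the edge vectors from \<open>i\<close> to \<open>j\<close>
  and to \<open>k\<close>. The Gram determinants \<open>gram_area\<close> and \<open>gram_volume\<close> of the edge vectors at \<open>i\<close> are
  4 times the squared area of the triangle and 36 times the squared volume of the tetrahedron.
\<close>

definition edge_inner :: "'v edge_fun \<Rightarrow> 'v \<Rightarrow> 'v \<Rightarrow> 'v \<Rightarrow> real" where
  "edge_inner d i j k = ((len d i j)\<^sup>2 + (len d i k)\<^sup>2 - (len d j k)\<^sup>2) / 2"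

definition gram_area :: "'v edge_fun \<Rightarrow> 'v \<Rightarrow> 'v \<Rightarrow> 'v \<Rightarrow> real" where
  "gram_area d i j k = (len d i j)\<^sup>2 * (len d i k)\<^sup>2 - (edge_inner d i j k)\<^sup>2"

definition gram_volume :: "'v edge_fun \<Rightarrow> 'v \<Rightarrow> 'v \<Rightarrow> 'v \<Rightarrow> 'v \<Rightarrow> real" where
  "gram_volume d i j k l =
     (len d i j)\<^sup>2 * (len d i k)\<^sup>2 * (len d i l)\<^sup>2 + 2 * edge_inner d i j k * edge_inner d i j l * edge_inner d i k l
     - (len d i j)\<^sup>2 * (edge_inner d i k l)\<^sup>2 - (len d i k)\<^sup>2 * (edge_inner d i j l)\<^sup>2 - (len d i l)\<^sup>2 * (edge_inner d i j k)\<^sup>2"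

text \<open>
  The inner product of the parts of the edge vectors to \<open>k\<close> and \<open>l\<close> orthogonal to the edge \<open>ij\<close>,
  times the squared length of that edge.
\<close>

definition gram_cofactor :: "'v edge_fun \<Rightarrow> 'v \<Rightarrow> 'v \<Rightarrow> 'v \<Rightarrow> 'v \<Rightarrow> real" where
  "gram_cofactor d i j k l = (len d i j)\<^sup>2 * edge_inner d i k l - edge_inner d i j k * edge_inner d i j l"

lemma len_commute: "len d i j = len d j i"
  by (simp add: len_def)

lemma edge_inner_commute: "edge_inner d i j k = edge_inner d i k j"
  by (simp add: edge_inner_def len_commute[of d j k])

lemma gram_area_commute: "gram_area d i j k = gram_area d i k j"
  by (simp add: gram_area_def edge_inner_commute[of d i j k])

lemma gram_volume_commute: "gram_volume d i j k l = gram_volume d i j l k"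
  and gram_volume_rotate: "gram_volume d i k l j = gram_volume d i j k l"
  by (simp_all add: gram_volume_def edge_inner_commute[of d i l k] edge_inner_commute[of d i k j] edge_inner_commute[of d i l j])

text \<open>
  The Desnanot-Jacobi identity for the Gram matrix. It provides the sine of a dihedral
  angle whose cosine has numerator \<open>gram_cofactor\<close>.
\<close>

lemma gram_cofactor_square:
  "gram_area d i j k * gram_area d i j l - (gram_cofactor d i j k l)\<^sup>2 = (len d i j)\<^sup>2 * gram_volume d i j k l"
  unfolding gram_area_def gram_cofactor_def gram_volume_def by (simp add: power2_eq_square algebra_simps)

lemma realizes_inner:
  assumes p: "realizes (len d) \<sigma> p" and i: "i \<in> \<sigma>" "j \<in> \<sigma>" "i \<noteq> j"
  shows "(p j - p i) \<bullet> (p j - p i) = (len d i j)\<^sup>2"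
    and "k \<in> \<sigma> \<Longrightarrow> k \<noteq> i \<Longrightarrow> k \<noteq> j \<Longrightarrow> (p j - p i) \<bullet> (p k - p i) = edge_inner d i j k"
proof -
  have *: "(p b - p a) \<bullet> (p b - p a) = (len d a b)\<^sup>2" if "a \<in> \<sigma>" "b \<in> \<sigma>" "a \<noteq> b" for a b
    using p that by (auto simp: realizes_def dist_norm norm_minus_commute power2_norm_eq_inner[symmetric])
  show "(p j - p i) \<bullet> (p j - p i) = (len d i j)\<^sup>2" by (rule *) fact+
  assume k: "k \<in> \<sigma>" "k \<noteq> i" "k \<noteq> j"
  have "(p k - p j) \<bullet> (p k - p j)
      = (p k - p i) \<bullet> (p k - p i) + (p j - p i) \<bullet> (p j - p i) - 2 * ((p j - p i) \<bullet> (p k - p i))"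
    by (simp add: inner_diff algebra_simps inner_commute)
  then show "(p j - p i) \<bullet> (p k - p i) = edge_inner d i j k"
    using *[of i j] *[of i k] *[of j k] i k by (simp add: edge_inner_def)
qed

lemma affine_independent_vectors:
  fixes p :: "'a \<Rightarrow> 'b::euclidean_space"
  assumes ind: "\<not> affine_dependent (p ` {i, j, k, l})" and inj: "inj_on p {i, j, k, l}"
    and dist: "distinct [i, j, k, l]"
  shows "p l - p i \<noteq> s *\<^sub>R (p j - p i) + t *\<^sub>R (p k - p i)"
proof
  assume *: "p l - p i = s *\<^sub>R (p j - p i) + t *\<^sub>R (p k - p i)"
  have "p l = (1 - s - t) *\<^sub>R p i + s *\<^sub>R p j + t *\<^sub>R p k"
    using * by (simp add: algebra_simps)
  then have "p l \<in> affine hull {p i, p j, p k}"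
    unfolding affine_hull_3 by (intro CollectI exI[of _ "1 - s - t"] exI[of _ s] exI[of _ t]) simp
  moreover have "p ` {i, j, k, l} - {p l} = {p i, p j, p k}"
    using inj dist by (auto simp: inj_on_def)
  ultimately show False
    using ind by (auto simp: affine_dependent_def)
qed

lemma realizes_subset:
  assumes "realizes L \<sigma> p" "\<tau> \<subseteq> \<sigma>"
  shows "realizes L \<tau> p"
  using assms unfolding realizes_def
  by (meson affine_dependent_subset image_mono inj_on_subset subsetD)

text \<open>
  All statements below concern the three edges at \<open>i\<close>. They are proved for the edge \<open>ij\<close> and carried
  over to the other two by rotating \<open>j, k, l\<close>.
\<close>

definition euclidean_tetra :: "'v::finite edge_fun \<Rightarrow> 'v \<Rightarrow> 'v \<Rightarrow> 'v \<Rightarrow> 'v \<Rightarrow> bool" where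
  "euclidean_tetra d i j k l \<longleftrightarrow> distinct [i, j, k, l] \<and> (\<exists>p. realizes (len d) {i, j, k, l} p)"

lemma euclidean_tetra_rotate: "euclidean_tetra d i j k l \<Longrightarrow> euclidean_tetra d i k l j"
  and euclidean_tetra_swap: "euclidean_tetra d i j k l \<Longrightarrow> euclidean_tetra d i j l k"
  by (auto simp: euclidean_tetra_def insert_commute)

lemma realizes_tetra_inner:
  assumes p: "realizes (len d) {i, j, k, l} p" and dist: "distinct [i, j, k, l]"
  shows "(p j - p i) \<bullet> (p j - p i) = (len d i j)\<^sup>2" "(p k - p i) \<bullet> (p k - p i) = (len d i k)\<^sup>2"
    "(p l - p i) \<bullet> (p l - p i) = (len d i l)\<^sup>2"
    "(p j - p i) \<bullet> (p k - p i) = edge_inner d i j k" "(p j - p i) \<bullet> (p l - p i) = edge_inner d i j l"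
    "(p k - p i) \<bullet> (p l - p i) = edge_inner d i k l"
  by ((rule realizes_inner(1)[OF p] | rule realizes_inner(2)[OF p]); use dist in auto)+

lemma euclidean_tetra_pos:
  assumes "euclidean_tetra d i j k l"
  shows "0 < len d i j" "0 < gram_area d i j k" "0 < gram_volume d i j k l"
proof -
  from assms obtain p where p: "realizes (len d) {i, j, k, l} p" and dist: "distinct [i, j, k, l]"
    by (auto simp: euclidean_tetra_def)
  then have ind: "\<not> affine_dependent (p ` {i, j, k, l})" and inj: "inj_on p {i, j, k, l}"
    by (auto simp: realizes_def)
  have ij: "p j - p i \<noteq> 0" using inj dist by (auto simp: inj_on_def)
  have "dist (p i) (p j) = len d i j" using p dist by (auto simp: realizes_def)
  then show "0 < len d i j" using ij by (metis dist_eq_0_iff eq_iff_diff_eq_0 zero_less_dist_iff)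
  have l: "p l - p i \<noteq> s *\<^sub>R (p j - p i) + t *\<^sub>R (p k - p i)" for s t
    using affine_independent_vectors[OF ind inj dist] .
  have "p k - p i \<noteq> s *\<^sub>R (p j - p i) + t *\<^sub>R (p l - p i)" for s t
    by (rule affine_independent_vectors) (use ind inj dist in \<open>auto simp: insert_commute\<close>)
  from this[of _ 0] have k: "p k - p i \<noteq> s *\<^sub>R (p j - p i)" for s by simp
  note inner = realizes_tetra_inner[OF p dist]
  show "0 < gram_area d i j k"
    using gram2_pos[OF ij k] inner by (simp add: gram_area_def)
  show "0 < gram_volume d i j k l"
    using gram3_pos[OF ij k l] inner by (simp add: gram_volume_def)
qed

lemma face_angle_eq:
  assumes "euclidean_tetra d i j k l"
  shows "face_angle d i j k = arccos (edge_inner d i j k / (len d i j * len d i k))"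
proof -
  from assms have dist: "distinct [i, j, k, l]" and ex: "\<exists>p. realizes (len d) {i, j, k} p"
    by (auto simp: euclidean_tetra_def intro: realizes_subset)
  define p where "p = (SOME p. realizes (len d) {i, j, k} p)"
  have p: "realizes (len d) {i, j, k} p"
    unfolding p_def using ex by (rule someI_ex)
  have "norm (p j - p i) = len d i j" "norm (p k - p i) = len d i k"
    using p dist by (auto simp: realizes_def dist_norm norm_minus_commute)
  moreover have "(p j - p i) \<bullet> (p k - p i) = edge_inner d i j k"
    by (rule realizes_inner(2)[OF p]) (use dist in auto)
  ultimately show ?thesis
    unfolding face_angle_def p_def[symmetric] Let_def vec_angle_def by simp
qed

lemma dihedral_eq:
  assumes "euclidean_tetra d i j k l"
  shows "dihedral d i j k l = arccos (gram_cofactor d i j k l / sqrt (gram_area d i j k * gram_area d i j l))"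
proof -
  from assms have dist: "distinct [i, j, k, l]" and ex: "\<exists>p. realizes (len d) {i, j, k, l} p"
    by (auto simp: euclidean_tetra_def)
  define p where "p = (SOME p. realizes (len d) {i, j, k, l} p)"
  have p: "realizes (len d) {i, j, k, l} p"
    unfolding p_def using ex by (rule someI_ex)
  then have "p j - p i \<noteq> 0" using dist by (auto simp: realizes_def inj_on_def)
  then show ?thesis
    unfolding dihedral_def p_def[symmetric] Let_def
    by (simp add: vec_angle_perp_part realizes_tetra_inner[OF p dist] gram_cofactor_def gram_area_def)
qed

lemma cos_sin_face_angle:
  assumes "euclidean_tetra d i j k l"
  shows "cos (face_angle d i j k) = edge_inner d i j k / (len d i j * len d i k)"
    and "sin (face_angle d i j k) = sqrt (gram_area d i j k) / (len d i j * len d i k)"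
proof -
  have "0 < len d i j * len d i k"
    using euclidean_tetra_pos(1)[OF assms] euclidean_tetra_pos(1)[OF euclidean_tetra_rotate[OF assms]] by simp
  moreover have "(edge_inner d i j k)\<^sup>2 + gram_area d i j k = (len d i j * len d i k)\<^sup>2"
    by (simp add: gram_area_def power_mult_distrib)
  ultimately show "cos (face_angle d i j k) = edge_inner d i j k / (len d i j * len d i k)"
    and "sin (face_angle d i j k) = sqrt (gram_area d i j k) / (len d i j * len d i k)"
    using cos_sin_arccos_quotient euclidean_tetra_pos(2)[OF assms]
    unfolding face_angle_eq[OF assms] by (simp_all add: less_imp_le)
qed

lemma cos_sin_dihedral:
  assumes "euclidean_tetra d i j k l"
  shows "cos (dihedral d i j k l) = gram_cofactor d i j k l / (sqrt (gram_area d i j k) * sqrt (gram_area d i j l))"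
    and "sin (dihedral d i j k l)
         = len d i j * sqrt (gram_volume d i j k l) / (sqrt (gram_area d i j k) * sqrt (gram_area d i j l))"
proof -
  note pos = euclidean_tetra_pos[OF assms] euclidean_tetra_pos(2)[OF euclidean_tetra_swap[OF assms]]
  let ?n = "sqrt (gram_area d i j k * gram_area d i j l)"
  have n: "0 < ?n" using pos by simp
  have "(gram_cofactor d i j k l)\<^sup>2 + (len d i j)\<^sup>2 * gram_volume d i j k l = ?n\<^sup>2"
    using pos gram_cofactor_square[of d i j k l] by simp
  from cos_sin_arccos_quotient[OF this _ n] pos
  show "cos (dihedral d i j k l) = gram_cofactor d i j k l / (sqrt (gram_area d i j k) * sqrt (gram_area d i j l))"
    and "sin (dihedral d i j k l)
         = len d i j * sqrt (gram_volume d i j k l) / (sqrt (gram_area d i j k) * sqrt (gram_area d i j l))"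
    unfolding dihedral_eq[OF assms] by (simp_all add: real_sqrt_mult)
qed

section \<open>The center and the signed heights\<close>

text \<open>
  The inner product of \<open>c - p\<^sub>i\<close> and \<open>p\<^sub>j - p\<^sub>i\<close>, where \<open>c\<close> is the center of a tetrahedron: its
  perpendicular to the edge has its foot at signed distance \<open>d i j\<close> from \<open>i\<close>.
\<close>

definition center_inner :: "'v edge_fun \<Rightarrow> 'v \<Rightarrow> 'v \<Rightarrow> real" where
  "center_inner d i j = d i j * len d i j"

text \<open>
  The vector from vertex \<open>i\<close> to the center is \<open>\<alpha>, \<beta>, \<gamma>\<close> times the edge vectors to \<open>j, k, l\<close>. Only the
  inner products with these three vectors occur, so no position of the tetrahedron has to be chosen.
\<close>

definition center_coords :: "'v edge_fun \<Rightarrow> 'v \<Rightarrow> 'v \<Rightarrow> 'v \<Rightarrow> 'v \<Rightarrow> real \<Rightarrow> real \<Rightarrow> real \<Rightarrow> bool" where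
  "center_coords d i j k l \<alpha> \<beta> \<gamma> \<longleftrightarrow>
     center_inner d i j = \<alpha> * (len d i j)\<^sup>2 + \<beta> * edge_inner d i j k + \<gamma> * edge_inner d i j l \<and>
     center_inner d i k = \<alpha> * edge_inner d i k j + \<beta> * (len d i k)\<^sup>2 + \<gamma> * edge_inner d i k l \<and>
     center_inner d i l = \<alpha> * edge_inner d i l j + \<beta> * edge_inner d i l k + \<gamma> * (len d i l)\<^sup>2"

lemma center_coords_rotate: "center_coords d i j k l \<alpha> \<beta> \<gamma> \<Longrightarrow> center_coords d i k l j \<beta> \<gamma> \<alpha>"
  and center_coords_swap: "center_coords d i j k l \<alpha> \<beta> \<gamma> \<Longrightarrow> center_coords d i j l k \<alpha> \<gamma> \<beta>"
  by (simp_all add: center_coords_def)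

lemma center_coords_exist:
  assumes "euclidean_tetra d i j k l"
  shows "\<exists>\<alpha> \<beta> \<gamma>. center_coords d i j k l \<alpha> \<beta> \<gamma>"
proof -
  \<comment> \<open>Cramer's rule, with the adjugate of the Gram matrix written out.\<close>
  have cramer: "\<exists>\<alpha> \<beta> \<gamma>. P = \<alpha> * A + \<beta> * x + \<gamma> * y \<and> Q = \<alpha> * x + \<beta> * B + \<gamma> * z \<and> R = \<alpha> * y + \<beta> * z + \<gamma> * E"
    if "D = A*B*E + 2*x*y*z - A*z\<^sup>2 - B*y\<^sup>2 - E*x\<^sup>2" "D \<noteq> 0" for A B E x y z P Q R D :: real
  proof (intro exI conjI)
    let ?a = "(P * (B*E - z\<^sup>2) + Q * (y*z - x*E) + R * (x*z - B*y))"
    let ?b = "(P * (y*z - x*E) + Q * (A*E - y\<^sup>2) + R * (x*y - A*z))"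
    let ?c = "(P * (x*z - B*y) + Q * (x*y - A*z) + R * (A*B - x\<^sup>2))"
    have "P * D = ?a * A + ?b * x + ?c * y" "Q * D = ?a * x + ?b * B + ?c * z" "R * D = ?a * y + ?b * z + ?c * E"
      unfolding that(1) by algebra+
    then show "P = ?a / D * A + ?b / D * x + ?c / D * y" "Q = ?a / D * x + ?b / D * B + ?c / D * z"
      "R = ?a / D * y + ?b / D * z + ?c / D * E"
      using that(2) by (simp_all add: eq_divide_eq flip: add_divide_distrib)
  qed
  have "gram_volume d i j k l \<noteq> 0" using euclidean_tetra_pos(3)[OF assms] by simp
  from cramer[OF gram_volume_def this] show ?thesis
    unfolding center_coords_def edge_inner_commute[of d i k j] edge_inner_commute[of d i l j] edge_inner_commute[of d i l k] by blast
qed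

lemma height2_eq:
  assumes "euclidean_tetra d i j k l"
  shows "height2 d i j k = (center_inner d i k * (len d i j)\<^sup>2 - center_inner d i j * edge_inner d i j k) / (len d i j * sqrt (gram_area d i j k))"
proof -
  have "0 < len d i j" "0 < len d i k" "0 < sqrt (gram_area d i j k)"
    using euclidean_tetra_pos[OF assms] euclidean_tetra_pos(1)[OF euclidean_tetra_rotate[OF assms]] by simp_all
  then show ?thesis
    unfolding height2_def cos_sin_face_angle[OF assms] center_inner_def
    by (simp add: field_simps power2_eq_square)
qed

text \<open>
  The signed distance from the center to the face \<open>ijk\<close> is its coordinate \<open>\<gamma>\<close> along the edge to \<open>l\<close>
  times the height of \<open>l\<close> over that face, and this height is the quotient of the two roots.
\<close>

lemma height3_eq:
  assumes "euclidean_tetra d i j k l" and c: "center_coords d i j k l \<alpha> \<beta> \<gamma>"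
  shows "height3 d i j k l = \<gamma> * sqrt (gram_volume d i j k l) / sqrt (gram_area d i j k)"
proof -
  define L where "L = len d i j"
  define s where "s = sqrt (gram_area d i j k)"
  define r where "r = sqrt (gram_area d i j l)"
  define v where "v = sqrt (gram_volume d i j k l)"
  note pos = euclidean_tetra_pos[OF assms(1)] euclidean_tetra_pos(2)[OF euclidean_tetra_swap[OF assms(1)]]
  have p: "0 < L" "0 < s" "0 < r" "0 < v" using pos by (simp_all add: L_def s_def r_def v_def)
  have sq: "s\<^sup>2 = gram_area d i j k" "r\<^sup>2 = gram_area d i j l" "v\<^sup>2 = gram_volume d i j k l"
    using pos by (simp_all add: s_def r_def v_def)
  define X where "X = center_inner d i k * L\<^sup>2 - center_inner d i j * edge_inner d i j k"
  define Y where "Y = center_inner d i l * L\<^sup>2 - center_inner d i j * edge_inner d i j l"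
  define u where "u = gram_cofactor d i j k l"
  \<comment> \<open>Replacing the edge vector to \<open>l\<close> by the vector to the center multiplies the determinant of the\<close>
  \<comment> \<open>three edge vectors by \<open>\<gamma>\<close>.\<close>
  have "Y * s\<^sup>2 - X * u = \<gamma> * (L\<^sup>2 * v\<^sup>2)"
    using c unfolding sq X_def Y_def u_def L_def center_coords_def gram_area_def gram_volume_def gram_cofactor_def
     edge_inner_commute[of d i k j] edge_inner_commute[of d i l j] edge_inner_commute[of d i l k]
    by algebra
  then have key: "(Y * s\<^sup>2 - X * u) / (L\<^sup>2 * s * v) = \<gamma> * v / s"
    using p by (simp add: field_simps power2_eq_square)
  have "height3 d i j k l = (Y / (L * r) - X / (L * s) * (u / (s * r))) / (L * v / (s * r))"
    unfolding height3_def height2_eq[OF assms(1)] height2_eq[OF euclidean_tetra_swap[OF assms(1)]]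
      cos_sin_dihedral[OF assms(1)] X_def Y_def L_def s_def r_def v_def u_def by simp
  also have "\<dots> = (Y * s\<^sup>2 - X * u) / (L\<^sup>2 * s * v)"
    using p by (simp add: field_simps power2_eq_square)
  finally show ?thesis using key by (simp add: s_def v_def)
qed

lemma dual_area_eq:
  assumes "euclidean_tetra d i j k l" and c: "center_coords d i j k l \<alpha> \<beta> \<gamma>"
  shows "2 * dual_area d i j k l / len d i j = sqrt (gram_volume d i j k l) / (len d i j)\<^sup>2 *
    (\<gamma> * (center_inner d i k * (len d i j)\<^sup>2 - center_inner d i j * edge_inner d i j k) / gram_area d i j k
   + \<beta> * (center_inner d i l * (len d i j)\<^sup>2 - center_inner d i j * edge_inner d i j l) / gram_area d i j l)"
proof -
  note pos = euclidean_tetra_pos[OF assms(1)] euclidean_tetra_pos(2)[OF euclidean_tetra_swap[OF assms(1)]]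
  have *: "2 * (1/2 * (X / (L * sqrt F) * (g * v / sqrt F) + Y / (L * sqrt G) * (b * v / sqrt G))) / L
     = v / L\<^sup>2 * (g * X / F + b * Y / G)" if "0 < L" "0 < F" "0 < G" for X Y L F G v g b :: real
  proof -
    have "X / (L * sqrt F) * (g * v / sqrt F) = v / L * (g * X / F)"
      using that real_sqrt_mult_self[of F] by (simp add: mult.assoc)
    moreover have "Y / (L * sqrt G) * (b * v / sqrt G) = v / L * (b * Y / G)"
      using that real_sqrt_mult_self[of G] by (simp add: mult.assoc)
    ultimately show ?thesis
      using that by (simp add: add_divide_distrib distrib_left power2_eq_square mult_ac)
  qed
  show ?thesis
    unfolding dual_area_def height2_eq[OF assms(1)] height2_eq[OF euclidean_tetra_swap[OF assms(1)]]
      height3_eq[OF assms] height3_eq[OF euclidean_tetra_swap[OF assms(1)] center_coords_swap[OF c]]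
      gram_volume_commute[of d i j l k]
    using * pos by simp
qed

section \<open>Conformal motions of a tetrahedron\<close>

text \<open>
  The infinitesimal content of a conformal variation on the vertices of one simplex: \<open>\<rho>\<close> stands for
  the derivatives of the conformal factors at time \<open>t\<close>.
\<close>

definition conformal_motion :: "'v set \<Rightarrow> (real \<Rightarrow> 'v edge_fun) \<Rightarrow> ('v \<Rightarrow> real) \<Rightarrow> real \<Rightarrow> bool" where
  "conformal_motion \<sigma> G \<rho> t \<longleftrightarrow>
     (\<forall>a\<in>\<sigma>. \<forall>b\<in>\<sigma>. a \<noteq> b \<longrightarrow>
        ((\<lambda>s. len (G s) a b) has_real_derivative G t a b * \<rho> a + G t b a * \<rho> b) (at t)) \<and>
     (\<forall>a\<in>\<sigma>. \<forall>b\<in>\<sigma>. \<forall>c\<in>\<sigma>. distinct [a, b, c] \<longrightarrow>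
        (G t a b)\<^sup>2 + (G t b c)\<^sup>2 + (G t c a)\<^sup>2 = (G t b a)\<^sup>2 + (G t a c)\<^sup>2 + (G t c b)\<^sup>2)"

lemma len_square_variation:
  assumes "conformal_motion \<sigma> G \<rho> t" "i \<in> \<sigma>" "j \<in> \<sigma>" "i \<noteq> j"
  shows "((\<lambda>s. (len (G s) i j)\<^sup>2) has_real_derivative
           2 * \<rho> i * (len (G t) i j)\<^sup>2 + 2 * (\<rho> j - \<rho> i) * ((len (G t) i j)\<^sup>2 - center_inner (G t) i j)) (at t)"
proof -
  have "((\<lambda>s. len (G s) i j) has_real_derivative G t i j * \<rho> i + G t j i * \<rho> j) (at t)"
    using assms by (auto simp: conformal_motion_def)
  from DERIV_power[OF this, of 2] show ?thesis
    by (rule DERIV_cong) (simp add: center_inner_def len_def power2_eq_square algebra_simps)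
qed

text \<open>
  The derivatives of the Gram matrix entries for the radial velocities \<open>\<rho>\<^sub>a (p\<^sub>a - c)\<close>. The triangle
  condition enters by expressing \<open>center_inner\<close> at \<open>j\<close> through its values at \<open>i\<close>: this is
  \<open>(c - p\<^sub>j) \<bullet> (p\<^sub>k - p\<^sub>j)\<close> expanded around \<open>p\<^sub>i\<close>.
\<close>

lemma edge_inner_variation:
  assumes m: "conformal_motion \<sigma> G \<rho> t" and \<sigma>: "i \<in> \<sigma>" "j \<in> \<sigma>" "k \<in> \<sigma>" "distinct [i, j, k]"
  shows "((\<lambda>s. edge_inner (G s) i j k) has_real_derivative
           2 * \<rho> i * edge_inner (G t) i j k + (\<rho> j - \<rho> i) * (edge_inner (G t) i j k - center_inner (G t) i k)
           + (\<rho> k - \<rho> i) * (edge_inner (G t) i j k - center_inner (G t) i j)) (at t)"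
proof -
  have tri: "(G t i j)\<^sup>2 + (G t j k)\<^sup>2 + (G t k i)\<^sup>2 = (G t j i)\<^sup>2 + (G t i k)\<^sup>2 + (G t k j)\<^sup>2"
    using m \<sigma> unfolding conformal_motion_def by blast
  have sq: "((\<lambda>s. (len (G s) a b)\<^sup>2) has_real_derivative
           2 * \<rho> a * (len (G t) a b)\<^sup>2 + 2 * (\<rho> b - \<rho> a) * ((len (G t) a b)\<^sup>2 - center_inner (G t) a b)) (at t)"
    if "a \<in> \<sigma>" "b \<in> \<sigma>" "a \<noteq> b" for a b using len_square_variation[OF m that] .
  have "((\<lambda>s. edge_inner (G s) i j k) has_real_derivative
     ((2 * \<rho> i * (len (G t) i j)\<^sup>2 + 2 * (\<rho> j - \<rho> i) * ((len (G t) i j)\<^sup>2 - center_inner (G t) i j))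
     + (2 * \<rho> i * (len (G t) i k)\<^sup>2 + 2 * (\<rho> k - \<rho> i) * ((len (G t) i k)\<^sup>2 - center_inner (G t) i k))
     - (2 * \<rho> j * (len (G t) j k)\<^sup>2 + 2 * (\<rho> k - \<rho> j) * ((len (G t) j k)\<^sup>2 - center_inner (G t) j k))) / 2) (at t)"
    unfolding edge_inner_def using \<sigma> by (intro DERIV_cdivide DERIV_diff DERIV_add sq) auto
  moreover have "2 * center_inner (G t) j k = (len (G t) j k)\<^sup>2 - 2 * center_inner (G t) i j + (len (G t) i j)\<^sup>2
       + 2 * center_inner (G t) i k - (len (G t) i k)\<^sup>2"
    using tri unfolding center_inner_def len_def power2_eq_square by (simp add: algebra_simps)
  ultimately show ?thesis
    unfolding edge_inner_def by (elim DERIV_cong) algebra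
qed

text \<open>
  The angle at the edge \<open>ij\<close> changes because the faces \<open>ijk\<close> and \<open>ijl\<close> turn. Each face contributes
  a multiple of the center's distance to it, hence the factors \<open>\<gamma>\<close> and \<open>\<beta>\<close>.
\<close>

lemma dihedral_variation:
  fixes G :: "real \<Rightarrow> 'v::finite edge_fun" and t :: real
  defines "d \<equiv> G t"
  assumes tet: "\<forall>\<^sub>F s in nhds t. euclidean_tetra (G s) i j k l"
    and m: "conformal_motion {i, j, k, l} G \<rho> t"
    and c: "center_coords d i j k l \<alpha> \<beta> \<gamma>"
  shows "((\<lambda>s. dihedral (G s) i j k l) has_real_derivative
     sqrt (gram_volume d i j k l) / len d i j *
       (((\<rho> k - \<rho> i) * (len d i j)\<^sup>2 - (\<rho> j - \<rho> i) * edge_inner d i j k) * \<gamma> / gram_area d i j k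
      + ((\<rho> l - \<rho> i) * (len d i j)\<^sup>2 - (\<rho> j - \<rho> i) * edge_inner d i j l) * \<beta> / gram_area d i j l)) (at t)"
    (is "(_ has_real_derivative sqrt ?D / ?L * ?S) _")
proof -
  have tt: "euclidean_tetra d i j k l"
    using eventually_nhds_x_imp_x[OF tet] by (simp add: d_def)
  then have dist: "distinct [i, j, k, l]" by (simp add: euclidean_tetra_def)
  note pos = euclidean_tetra_pos[OF tt] euclidean_tetra_pos(2)[OF euclidean_tetra_swap[OF tt]]
  define A' where "A' = 2 * \<rho> i * (len d i j)\<^sup>2 + 2 * (\<rho> j - \<rho> i) * ((len d i j)\<^sup>2 - center_inner d i j)"
  define B' where "B' = 2 * \<rho> i * (len d i k)\<^sup>2 + 2 * (\<rho> k - \<rho> i) * ((len d i k)\<^sup>2 - center_inner d i k)"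
  define E' where "E' = 2 * \<rho> i * (len d i l)\<^sup>2 + 2 * (\<rho> l - \<rho> i) * ((len d i l)\<^sup>2 - center_inner d i l)"
  define x' where "x' = 2 * \<rho> i * edge_inner d i j k + (\<rho> j - \<rho> i) * (edge_inner d i j k - center_inner d i k)
           + (\<rho> k - \<rho> i) * (edge_inner d i j k - center_inner d i j)"
  define y' where "y' = 2 * \<rho> i * edge_inner d i j l + (\<rho> j - \<rho> i) * (edge_inner d i j l - center_inner d i l)
           + (\<rho> l - \<rho> i) * (edge_inner d i j l - center_inner d i j)"
  define z' where "z' = 2 * \<rho> i * edge_inner d i k l + (\<rho> k - \<rho> i) * (edge_inner d i k l - center_inner d i l)
           + (\<rho> l - \<rho> i) * (edge_inner d i k l - center_inner d i k)"
  have A: "((\<lambda>s. (len (G s) i j)\<^sup>2) has_real_derivative A') (at t)"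
    unfolding A'_def d_def by (rule len_square_variation[OF m]) (use dist in auto)
  have B: "((\<lambda>s. (len (G s) i k)\<^sup>2) has_real_derivative B') (at t)"
    unfolding B'_def d_def by (rule len_square_variation[OF m]) (use dist in auto)
  have E: "((\<lambda>s. (len (G s) i l)\<^sup>2) has_real_derivative E') (at t)"
    unfolding E'_def d_def by (rule len_square_variation[OF m]) (use dist in auto)
  have x: "((\<lambda>s. edge_inner (G s) i j k) has_real_derivative x') (at t)"
    unfolding x'_def d_def by (rule edge_inner_variation[OF m]) (use dist in auto)
  have y: "((\<lambda>s. edge_inner (G s) i j l) has_real_derivative y') (at t)"
    unfolding y'_def d_def by (rule edge_inner_variation[OF m]) (use dist in auto)
  have z: "((\<lambda>s. edge_inner (G s) i k l) has_real_derivative z') (at t)"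
    unfolding z'_def d_def by (rule edge_inner_variation[OF m]) (use dist in auto)
  define F' where "F' = A' * (len d i k)\<^sup>2 + (len d i j)\<^sup>2 * B' - 2 * edge_inner d i j k * x'"
  define H' where "H' = A' * (len d i l)\<^sup>2 + (len d i j)\<^sup>2 * E' - 2 * edge_inner d i j l * y'"
  define u' where "u' = A' * edge_inner d i k l + (len d i j)\<^sup>2 * z' - (x' * edge_inner d i j l + edge_inner d i j k * y')"
  have F: "((\<lambda>s. gram_area (G s) i j k) has_real_derivative F') (at t)"
    unfolding gram_area_def
    by (rule DERIV_cong, rule DERIV_diff[OF DERIV_mult'[OF A B] DERIV_power[OF x]])
       (simp add: F'_def d_def)
  have H: "((\<lambda>s. gram_area (G s) i j l) has_real_derivative H') (at t)"
    unfolding gram_area_def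
    by (rule DERIV_cong, rule DERIV_diff[OF DERIV_mult'[OF A E] DERIV_power[OF y]])
       (simp add: H'_def d_def)
  have u: "((\<lambda>s. gram_cofactor (G s) i j k l) has_real_derivative u') (at t)"
    unfolding gram_cofactor_def
    by (rule DERIV_cong, rule DERIV_diff[OF DERIV_mult'[OF A z] DERIV_mult'[OF x y]])
       (simp add: u'_def d_def)
  have alg: "u' - gram_cofactor d i j k l / 2 * (F' / gram_area d i j k + H' / gram_area d i j l) = - ?D * ?S"
  proof (rule dihedral_variation_algebra)
    show "center_inner d i j = \<alpha> * (len d i j)\<^sup>2 + \<beta> * edge_inner d i j k + \<gamma> * edge_inner d i j l"
      "center_inner d i k = \<alpha> * edge_inner d i j k + \<beta> * (len d i k)\<^sup>2 + \<gamma> * edge_inner d i k l"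
      "center_inner d i l = \<alpha> * edge_inner d i j l + \<beta> * edge_inner d i k l + \<gamma> * (len d i l)\<^sup>2"
      using c by (simp_all add: center_coords_def edge_inner_commute[of d i k j] edge_inner_commute[of d i l j] edge_inner_commute[of d i l k])
    show "gram_area d i j k \<noteq> 0" "gram_area d i j l \<noteq> 0" using pos by simp_all
  qed (simp_all only: gram_area_def gram_cofactor_def gram_volume_def F'_def H'_def u'_def A'_def B'_def E'_def x'_def y'_def z'_def)
  have W: "?L\<^sup>2 * ?D = gram_area (G t) i j k * gram_area (G t) i j l - (gram_cofactor (G t) i j k l)\<^sup>2"
    unfolding d_def by (simp add: gram_cofactor_square)
  have "((\<lambda>s. arccos (gram_cofactor (G s) i j k l / sqrt (gram_area (G s) i j k * gram_area (G s) i j l)))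
      has_real_derivative - (u' - gram_cofactor d i j k l / 2 * (F' / gram_area d i j k + H' / gram_area d i j l)) / sqrt (?L\<^sup>2 * ?D)) (at t)"
    using DERIV_arccos_quotient[OF u F H _ _ W] pos unfolding d_def by simp
  also have "- (u' - gram_cofactor d i j k l / 2 * (F' / gram_area d i j k + H' / gram_area d i j l)) / sqrt (?L\<^sup>2 * ?D)
     = ?D * ?S / (?L * sqrt ?D)"
    unfolding alg using pos by (simp add: real_sqrt_mult)
  also have "\<dots> = ?D / sqrt ?D / ?L * ?S"
    by simp
  also have "\<dots> = sqrt ?D / ?L * ?S"
    using pos by (simp only: real_div_sqrt less_imp_le)
  finally show ?thesis
    by (rule DERIV_cong_ev[THEN iffD1, rotated -1, OF _ refl _ refl])
       (use tet in \<open>auto elim!: eventually_mono simp: dihedral_eq\<close>)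
qed

lemma dihedral_differentiable:
  assumes "\<forall>\<^sub>F s in nhds t. euclidean_tetra (G s) i j k l" "conformal_motion {i, j, k, l} G \<rho> t"
  shows "((\<lambda>s. dihedral (G s) i j k l) has_real_derivative deriv (\<lambda>s. dihedral (G s) i j k l) t) (at t)"
  using center_coords_exist[OF eventually_nhds_x_imp_x[OF assms(1)]] dihedral_variation[OF assms]
  by (metis DERIV_imp_deriv)

text \<open>
  With the formulas for the angle derivatives and for the dual areas, both sides are combinations of
  the coordinates \<open>\<alpha>, \<beta>, \<gamma>\<close> with the same coefficients: the contribution of \<open>\<rho> j - \<rho> i\<close> to the angles at
  \<open>ij\<close> and \<open>ik\<close> through the face \<open>ijk\<close> combines into the height of the center over \<open>ij\<close> in that face.
\<close>

lemma tetra_variation: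
  fixes G :: "real \<Rightarrow> 'v::finite edge_fun" and t :: real
  defines "d \<equiv> G t"
  assumes tet: "\<forall>\<^sub>F s in nhds t. euclidean_tetra (G s) i j k l"
    and m: "conformal_motion {i, j, k, l} G \<rho> t"
  shows "deriv (\<lambda>s. dihedral (G s) i j k l) t * d i j + deriv (\<lambda>s. dihedral (G s) i k l j) t * d i k
         + deriv (\<lambda>s. dihedral (G s) i l j k) t * d i l
       = 2 * (dual_area d i j k l / len d i j * (\<rho> j - \<rho> i) + dual_area d i k l j / len d i k * (\<rho> k - \<rho> i)
         + dual_area d i l j k / len d i l * (\<rho> l - \<rho> i))"
proof -
  have tt: "euclidean_tetra d i j k l"
    using eventually_nhds_x_imp_x[OF tet] by (simp add: d_def)
  note tt2 = euclidean_tetra_rotate[OF tt] note tt3 = euclidean_tetra_rotate[OF tt2]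
  obtain \<alpha> \<beta> \<gamma> where c: "center_coords d i j k l \<alpha> \<beta> \<gamma>" using center_coords_exist[OF tt] by blast
  note c2 = center_coords_rotate[OF c] note c3 = center_coords_rotate[OF c2]
  have tet2: "\<forall>\<^sub>F s in nhds t. euclidean_tetra (G s) i k l j"
    using tet by (rule eventually_mono) (rule euclidean_tetra_rotate)
  have tet3: "\<forall>\<^sub>F s in nhds t. euclidean_tetra (G s) i l j k"
    using tet2 by (rule eventually_mono) (rule euclidean_tetra_rotate)
  have m2: "conformal_motion {i, k, l, j} G \<rho> t" and m3: "conformal_motion {i, l, j, k} G \<rho> t"
    using m by (simp_all add: insert_commute)
  have vol: "gram_volume d i k l j = gram_volume d i j k l" "gram_volume d i l j k = gram_volume d i j k l"
    by (simp_all only: gram_volume_rotate)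
  have sym: "gram_area d i k j = gram_area d i j k" "gram_area d i l j = gram_area d i j l" "gram_area d i l k = gram_area d i k l"
    "edge_inner d i k j = edge_inner d i j k" "edge_inner d i l j = edge_inner d i j l" "edge_inner d i l k = edge_inner d i k l"
    by (simp_all only: gram_area_commute edge_inner_commute)
  have dd: "d i j = center_inner d i j / len d i j" "d i k = center_inner d i k / len d i k" "d i l = center_inner d i l / len d i l"
    using euclidean_tetra_pos(1)[OF tt] euclidean_tetra_pos(1)[OF tt2] euclidean_tetra_pos(1)[OF tt3]
    by (simp_all add: center_inner_def)
  have area2: "2 * (a / b * e + a' / b' * e' + a'' / b'' * e'') = 2 * a / b * e + 2 * a' / b' * e' + 2 * a'' / b'' * e''"
    for a b e a' b' e' a'' b'' e'' :: real by simp
  \<comment> \<open>Here \<open>a, b, e\<close> are the lengths of the edges at \<open>i\<close>, \<open>f, g, h\<close> belong to the faces \<open>ijk, ijl, ikl\<close>, and\<close>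
  \<comment> \<open>\<open>p, q, r\<close> are the rates relative to \<open>i\<close>. Both sides are equal face by face.\<close>
  have alg: "v / a * ((q * a\<^sup>2 - p * x) * \<gamma> / f + (r * a\<^sup>2 - p * y) * \<beta> / g) * (P / a)
      + v / b * ((r * b\<^sup>2 - q * z) * \<alpha> / h + (p * b\<^sup>2 - q * x) * \<gamma> / f) * (Q / b)
      + v / e * ((p * e\<^sup>2 - r * y) * \<beta> / g + (q * e\<^sup>2 - r * z) * \<alpha> / h) * (R / e)
    = v / a\<^sup>2 * (\<gamma> * (Q * a\<^sup>2 - P * x) / f + \<beta> * (R * a\<^sup>2 - P * y) / g) * p
      + v / b\<^sup>2 * (\<alpha> * (R * b\<^sup>2 - Q * z) / h + \<gamma> * (P * b\<^sup>2 - Q * x) / f) * q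
      + v / e\<^sup>2 * (\<beta> * (P * e\<^sup>2 - R * y) / g + \<alpha> * (Q * e\<^sup>2 - R * z) / h) * r"
    if "a \<noteq> 0" "b \<noteq> 0" "e \<noteq> 0" for a b e f g h p q r x y z P Q R v :: real
  proof -
    have *: "v / a * ((q * a\<^sup>2 - p * x) * \<gamma> / f + (r * a\<^sup>2 - p * y) * \<beta> / g) * (P / a)
       = v * P * ((q - p * x / a\<^sup>2) * (\<gamma> / f) + (r - p * y / a\<^sup>2) * (\<beta> / g))"
      "v / a\<^sup>2 * (\<gamma> * (Q * a\<^sup>2 - P * x) / f + \<beta> * (R * a\<^sup>2 - P * y) / g) * p
       = v * p * ((Q - P * x / a\<^sup>2) * (\<gamma> / f) + (R - P * y / a\<^sup>2) * (\<beta> / g))"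
      if "a \<noteq> 0" for a q p x \<gamma> f r y \<beta> g P Q R :: real
    proof -
      have "(q * a\<^sup>2 - p * x) = a\<^sup>2 * (q - p * x / a\<^sup>2)" for q p x using that by (simp add: right_diff_distrib)
      then show "v / a * ((q * a\<^sup>2 - p * x) * \<gamma> / f + (r * a\<^sup>2 - p * y) * \<beta> / g) * (P / a)
         = v * P * ((q - p * x / a\<^sup>2) * (\<gamma> / f) + (r - p * y / a\<^sup>2) * (\<beta> / g))"
      "v / a\<^sup>2 * (\<gamma> * (Q * a\<^sup>2 - P * x) / f + \<beta> * (R * a\<^sup>2 - P * y) / g) * p
       = v * p * ((Q - P * x / a\<^sup>2) * (\<gamma> / f) + (R - P * y / a\<^sup>2) * (\<beta> / g))"
        using that by (simp_all only: power2_eq_square) (simp_all add: algebra_simps add_divide_distrib diff_divide_distrib)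
    qed
    show ?thesis unfolding *[OF that(1)] *[OF that(2)] *[OF that(3)]
      by (simp add: algebra_simps)
  qed
  show ?thesis
    unfolding dihedral_variation[OF tet m c[unfolded d_def], THEN DERIV_imp_deriv, folded d_def]
      dihedral_variation[OF tet2 m2 c2[unfolded d_def], THEN DERIV_imp_deriv, folded d_def]
      dihedral_variation[OF tet3 m3 c3[unfolded d_def], THEN DERIV_imp_deriv, folded d_def]
      area2 dual_area_eq[OF tt c] dual_area_eq[OF tt2 c2] dual_area_eq[OF tt3 c3]
      vol sym dd
    by (rule alg) (use euclidean_tetra_pos(1)[OF tt] euclidean_tetra_pos(1)[OF tt2] euclidean_tetra_pos(1)[OF tt3] in auto)
qed

section \<open>Partial derivatives\<close>

lemma partial_has_derivative:
  assumes "(g has_derivative g') (at x)"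
  shows "((\<lambda>s. g (x + s *\<^sub>R axis k 1)) has_real_derivative g' (axis k 1)) (at 0)"
    and "partial k g x = g' (axis k 1)"
proof -
  have lin: "linear g'" using assms by (rule has_derivative_linear)
  have "((\<lambda>s::real. x + s *\<^sub>R axis k 1) has_derivative (\<lambda>s. s *\<^sub>R axis k 1)) (at 0)"
    by (auto intro!: derivative_eq_intros)
  then have "((\<lambda>s. g (x + s *\<^sub>R axis k 1)) has_derivative (\<lambda>s. g' (s *\<^sub>R axis k 1))) (at 0)"
    by (rule has_derivative_compose) (use assms in simp)
  moreover have "(\<lambda>s. g' (s *\<^sub>R axis k 1)) = (*) (g' (axis k 1))"
    by (simp add: fun_eq_iff linear_scale[OF lin])
  ultimately show *: "((\<lambda>s. g (x + s *\<^sub>R axis k 1)) has_real_derivative g' (axis k 1)) (at 0)"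
    by (simp add: has_field_derivative_def)
  then show "partial k g x = g' (axis k 1)"
    unfolding partial_def by (rule DERIV_imp_deriv)
qed

lemma partial_cong:
  assumes "\<forall>\<^sub>F y in nhds x. g y = h y"
  shows "partial k g x = partial k h x"
proof -
  have "((\<lambda>s::real. x + s *\<^sub>R axis k 1) \<longlongrightarrow> x + 0 *\<^sub>R axis k 1) (nhds 0)"
    by (intro tendsto_intros filterlim_ident)
  then have "filterlim (\<lambda>s::real. x + s *\<^sub>R axis k 1) (nhds x) (nhds 0)" by simp
  from eventually_compose_filterlim[OF assms this] show ?thesis
    unfolding partial_def by (rule deriv_cong_ev) simp
qed

lemma partial_chain_rule:
  fixes g :: "real ^ 'v::finite \<Rightarrow> real" and f :: "real \<Rightarrow> real ^ 'v"
  assumes "g differentiable (at (f t))" "f differentiable (at t)"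
  shows "((\<lambda>s. g (f s)) has_real_derivative
           (\<Sum>k\<in>UNIV. partial k g (f t) * deriv (\<lambda>s. f s $ k) t)) (at t)"
proof -
  obtain g' f' where g': "(g has_derivative g') (at (f t))" and f': "(f has_derivative f') (at t)"
    using assms by (auto simp: differentiable_def)
  have lin: "linear g'" "linear f'" using g' f' by (auto intro: has_derivative_linear)
  have f'1: "f' h = h *\<^sub>R f' 1" for h
    using linear_scale[OF lin(2), of h 1] by simp
  have comp: "deriv (\<lambda>s. f s $ k) t = f' 1 $ k" for k
  proof -
    have "((\<lambda>s. f s $ k) has_derivative (*) (f' 1 $ k)) (at t)"
    proof (rule has_derivative_eq_rhs)
      show "((\<lambda>s. f s $ k) has_derivative (\<lambda>h. f' h $ k)) (at t)"
        using f' by (rule bounded_linear.has_derivative[OF bounded_linear_vec_nth])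
      show "(\<lambda>h. f' h $ k) = (*) (f' 1 $ k)"
        by (rule ext, subst f'1) simp
    qed
    then show ?thesis
      by (intro DERIV_imp_deriv) (simp add: has_field_derivative_def)
  qed
  have "f' 1 = (\<Sum>k\<in>UNIV. (f' 1 $ k) *\<^sub>R axis k 1)"
    using basis_expansion[of "f' 1"] by (simp add: scalar_mult_eq_scaleR)
  then have "g' (f' 1) = g' (\<Sum>k\<in>UNIV. (f' 1 $ k) *\<^sub>R axis k 1)"
    by (rule arg_cong)
  also have "\<dots> = (\<Sum>k\<in>UNIV. (f' 1 $ k) * g' (axis k 1))"
    by (simp add: linear_sum[OF lin(1)] linear_scale[OF lin(1)])
  finally have eq: "g' (f' 1) = (\<Sum>k\<in>UNIV. partial k g (f t) * deriv (\<lambda>s. f s $ k) t)"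
    by (simp add: comp partial_has_derivative(2)[OF g'] mult.commute)
  have "((\<lambda>s. g (f s)) has_derivative (*) (g' (f' 1))) (at t)"
  proof (rule has_derivative_eq_rhs)
    show "((\<lambda>s. g (f s)) has_derivative (\<lambda>h. g' (f' h))) (at t)"
      using f' g' by (rule has_derivative_compose)
    show "(\<lambda>h. g' (f' h)) = (*) (g' (f' 1))"
      by (rule ext, subst f'1) (simp add: linear_scale[OF lin(1)])
  qed
  then show ?thesis
    by (simp add: has_field_derivative_def eq)
qed

text \<open>
  Schwarz's theorem for two real variables. By the mean value theorem, applied in the two possible
  orders, the second difference of \<open>\<phi>\<close> over a square of side \<open>h\<close> is \<open>h * h\<close> times a value of \<open>P\<close> and
  also \<open>h * h\<close> times a value of \<open>R\<close>, both in the square; let \<open>h\<close> tend to 0.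
\<close>

lemma mixed_second_derivatives_eq:
  fixes \<phi> p r P R :: "real \<Rightarrow> real \<Rightarrow> real"
  assumes "0 < \<delta>"
    and p: "\<And>s t. \<lbrakk>\<bar>s\<bar> < \<delta>; \<bar>t\<bar> < \<delta>\<rbrakk> \<Longrightarrow> ((\<lambda>s. \<phi> s t) has_real_derivative p s t) (at s)"
    and r: "\<And>s t. \<lbrakk>\<bar>s\<bar> < \<delta>; \<bar>t\<bar> < \<delta>\<rbrakk> \<Longrightarrow> ((\<lambda>t. \<phi> s t) has_real_derivative r s t) (at t)"
    and P: "\<And>s t. \<lbrakk>\<bar>s\<bar> < \<delta>; \<bar>t\<bar> < \<delta>\<rbrakk> \<Longrightarrow> ((\<lambda>t. p s t) has_real_derivative P s t) (at t)"
    and R: "\<And>s t. \<lbrakk>\<bar>s\<bar> < \<delta>; \<bar>t\<bar> < \<delta>\<rbrakk> \<Longrightarrow> ((\<lambda>s. r s t) has_real_derivative R s t) (at s)"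
    and cP: "isCont (\<lambda>(s, t). P s t) (0, 0)" and cR: "isCont (\<lambda>(s, t). R s t) (0, 0)"
  shows "P 0 0 = R 0 0"
proof -
  have pts: "\<exists>\<xi> \<eta> \<xi>' \<eta>'. \<bar>\<xi>\<bar> < h \<and> \<bar>\<eta>\<bar> < h \<and> \<bar>\<xi>'\<bar> < h \<and> \<bar>\<eta>'\<bar> < h \<and> P \<xi> \<eta> = R \<xi>' \<eta>'"
    if h: "0 < h" "h < \<delta>" for h
  proof -
    have "((\<lambda>s. \<phi> s h - \<phi> s 0) has_real_derivative p z h - p z 0) (at z)" if "0 \<le> z" "z \<le> h" for z
      using h that by (intro DERIV_diff p) simp_all
    from MVT2[OF h(1) this] obtain \<xi> where \<xi>: "0 < \<xi>" "\<xi> < h"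
      "(\<phi> h h - \<phi> h 0) - (\<phi> 0 h - \<phi> 0 0) = (h - 0) * (p \<xi> h - p \<xi> 0)" by blast
    have "((\<lambda>t. p \<xi> t) has_real_derivative P \<xi> z) (at z)" if "0 \<le> z" "z \<le> h" for z
      using h \<xi> that by (intro P) simp_all
    from MVT2[OF h(1) this] obtain \<eta> where \<eta>: "0 < \<eta>" "\<eta> < h"
      "p \<xi> h - p \<xi> 0 = (h - 0) * P \<xi> \<eta>" by blast
    have "((\<lambda>t. \<phi> h t - \<phi> 0 t) has_real_derivative r h z - r 0 z) (at z)" if "0 \<le> z" "z \<le> h" for z
      using h that by (intro DERIV_diff r) simp_all
    from MVT2[OF h(1) this] obtain \<eta>' where \<eta>': "0 < \<eta>'" "\<eta>' < h"
      "(\<phi> h h - \<phi> 0 h) - (\<phi> h 0 - \<phi> 0 0) = (h - 0) * (r h \<eta>' - r 0 \<eta>')" by blast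
    have "((\<lambda>s. r s \<eta>') has_real_derivative R z \<eta>') (at z)" if "0 \<le> z" "z \<le> h" for z
      using h \<eta>' that by (intro R) simp_all
    from MVT2[OF h(1) this] obtain \<xi>' where \<xi>': "0 < \<xi>'" "\<xi>' < h"
      "r h \<eta>' - r 0 \<eta>' = (h - 0) * R \<xi>' \<eta>'" by blast
    have "h * (h * P \<xi> \<eta>) = h * (h * R \<xi>' \<eta>')"
      using \<xi>(3) \<eta>'(3) unfolding \<eta>(3) \<xi>'(3) diff_zero by linarith
    then have "P \<xi> \<eta> = R \<xi>' \<eta>'" using h by simp
    then show ?thesis using \<xi> \<eta> \<xi>' \<eta>' by (intro exI[of _ \<xi>] exI[of _ \<eta>] exI[of _ \<xi>'] exI[of _ \<eta>']) auto
  qed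
  show ?thesis
  proof (rule ccontr)
    assume "P 0 0 \<noteq> R 0 0"
    define e where "e = dist (P 0 0) (R 0 0) / 2"
    have e: "0 < e" using \<open>P 0 0 \<noteq> R 0 0\<close> by (simp add: e_def)
    obtain \<delta>1 where \<delta>1: "0 < \<delta>1" "\<And>z. dist z (0, 0) < \<delta>1 \<Longrightarrow> dist (case z of (s, t) \<Rightarrow> P s t) (P 0 0) < e"
      using cP e unfolding continuous_at_eps_delta by fastforce
    obtain \<delta>2 where \<delta>2: "0 < \<delta>2" "\<And>z. dist z (0, 0) < \<delta>2 \<Longrightarrow> dist (case z of (s, t) \<Rightarrow> R s t) (R 0 0) < e"
      using cR e unfolding continuous_at_eps_delta by fastforce
    define h where "h = min \<delta> (min \<delta>1 \<delta>2) / 2"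
    have h: "0 < h" "h < \<delta>" "2 * h \<le> \<delta>1" "2 * h \<le> \<delta>2"
      using \<open>0 < \<delta>\<close> \<delta>1(1) \<delta>2(1) by (auto simp: h_def)
    obtain \<xi> \<eta> \<xi>' \<eta>' where pt: "\<bar>\<xi>\<bar> < h" "\<bar>\<eta>\<bar> < h" "\<bar>\<xi>'\<bar> < h" "\<bar>\<eta>'\<bar> < h" "P \<xi> \<eta> = R \<xi>' \<eta>'"
      using pts[OF h(1,2)] by blast
    have near: "dist (a, b) (0, 0) < 2 * h" if "\<bar>a\<bar> < h" "\<bar>b\<bar> < h" for a b :: real
      using sqrt_sum_squares_le_sum_abs[of a b] that by (simp add: dist_Pair_Pair)
    have "dist (P \<xi> \<eta>) (P 0 0) < e" "dist (R \<xi>' \<eta>') (R 0 0) < e"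
      using \<delta>1(2)[of "(\<xi>, \<eta>)"] \<delta>2(2)[of "(\<xi>', \<eta>')"] near[OF pt(1,2)] near[OF pt(3,4)] h by auto
    then have "dist (P 0 0) (R 0 0) < 2 * e"
      using pt(5) dist_triangle3[of "P 0 0" "R 0 0" "P \<xi> \<eta>"] by simp
    then show False by (simp add: e_def)
  qed
qed

text \<open>
  The previous lemma on the plane through \<open>x\<close> spanned by the two coordinate directions.
\<close>

lemma mixed_partials_eq:
  fixes g p r :: "real ^ 'v::finite \<Rightarrow> real"
  assumes U: "open U" "x \<in> U"
    and g: "\<And>y. y \<in> U \<Longrightarrow> g differentiable (at y)"
    and pg: "\<And>y. y \<in> U \<Longrightarrow> partial i g y = p y" and rg: "\<And>y. y \<in> U \<Longrightarrow> partial j g y = r y"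
    and p: "Ck_on 1 U p" and r: "Ck_on 1 U r"
  shows "partial j p x = partial i r x"
proof -
  let ?e = "\<lambda>k. axis k (1::real) :: real ^ 'v"
  obtain \<delta>0 where \<delta>0: "0 < \<delta>0" "ball x \<delta>0 \<subseteq> U"
    using U open_contains_ball by blast
  define \<delta> where "\<delta> = \<delta>0 / 2"
  define y where "y s t = x + s *\<^sub>R ?e i + t *\<^sub>R ?e j" for s t
  have yU: "y s t \<in> U" if "\<bar>s\<bar> < \<delta>" "\<bar>t\<bar> < \<delta>" for s t
  proof -
    have "y s t - x = s *\<^sub>R ?e i + t *\<^sub>R ?e j" by (simp add: y_def)
    then have "dist x (y s t) = norm (s *\<^sub>R ?e i + t *\<^sub>R ?e j)"
      by (metis dist_commute dist_norm)
    also have "\<dots> \<le> norm (s *\<^sub>R ?e i) + norm (t *\<^sub>R ?e j)"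
      by (rule norm_triangle_ineq)
    also have "\<dots> < \<delta>0" using that by (simp add: \<delta>_def)
    finally show ?thesis using \<delta>0 by auto
  qed
  have diff: "(q has_derivative frechet_derivative q (at z)) (at z)" if "q differentiable (at z)" for q :: "real ^ 'v \<Rightarrow> real" and z
    using that by (simp add: frechet_derivative_works)
  have dir_i: "((\<lambda>s. q (y s t)) has_real_derivative partial i q (y s t)) (at s)"
    if "q differentiable (at (y s t))" for q :: "real ^ 'v \<Rightarrow> real" and s t
  proof -
    have "y s t + u *\<^sub>R ?e i = y (u + s) t" for u
      by (simp add: y_def scaleR_add_left)
    then show ?thesis
      using partial_has_derivative[OF diff[OF that], of i] DERIV_shift[of "\<lambda>s. q (y s t)" _ 0 s]
      by simp
  qed
  have dir_j: "((\<lambda>t. q (y s t)) has_real_derivative partial j q (y s t)) (at t)"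
    if "q differentiable (at (y s t))" for q :: "real ^ 'v \<Rightarrow> real" and s t
  proof -
    have "y s t + u *\<^sub>R ?e j = y s (u + t)" for u
      by (simp add: y_def scaleR_add_left)
    then show ?thesis
      using partial_has_derivative[OF diff[OF that], of j] DERIV_shift[of "\<lambda>t. q (y s t)" _ 0 t]
      by simp
  qed
  have pd: "\<And>z. z \<in> U \<Longrightarrow> p differentiable (at z)" and rd: "\<And>z. z \<in> U \<Longrightarrow> r differentiable (at z)"
    using p r by auto
  have cont: "isCont (\<lambda>(s, t). partial k q (y s t)) (0, 0)" if "Ck_on 1 U q" for q k
  proof -
    have qd: "q differentiable (at z)" if "z \<in> U" for z using \<open>Ck_on 1 U q\<close> that by auto
    have "continuous_on U (\<lambda>z. frechet_derivative q (at z) (?e k))"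
      using that by simp
    then have "continuous_on U (partial k q)"
      by (rule continuous_on_eq) (use partial_has_derivative(2)[OF diff[OF qd]] in simp)
    then have at_x: "isCont (partial k q) x" using U by (simp add: continuous_on_eq_continuous_at)
    have "isCont (\<lambda>z. y (fst z) (snd z)) (0, 0)"
      unfolding y_def by (intro continuous_intros)
    then have "isCont (\<lambda>z. partial k q (y (fst z) (snd z))) (0, 0)"
      by (rule isCont_o2) (use at_x in \<open>simp add: y_def\<close>)
    then show ?thesis by (simp add: case_prod_unfold)
  qed
  have "partial j p (y 0 0) = partial i r (y 0 0)"
  proof (rule mixed_second_derivatives_eq[where \<phi> = "\<lambda>s t. g (y s t)" and p = "\<lambda>s t. p (y s t)" and r = "\<lambda>s t. r (y s t)"
        and P = "\<lambda>s t. partial j p (y s t)" and R = "\<lambda>s t. partial i r (y s t)" and \<delta> = \<delta>])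
    show "0 < \<delta>" using \<delta>0 by (simp add: \<delta>_def)
    show "((\<lambda>s. g (y s t)) has_real_derivative p (y s t)) (at s)" if "\<bar>s\<bar> < \<delta>" "\<bar>t\<bar> < \<delta>" for s t
      using dir_i[OF g[OF yU[OF that]]] pg[OF yU[OF that]] by simp
    show "((\<lambda>t. g (y s t)) has_real_derivative r (y s t)) (at t)" if "\<bar>s\<bar> < \<delta>" "\<bar>t\<bar> < \<delta>" for s t
      using dir_j[OF g[OF yU[OF that]]] rg[OF yU[OF that]] by simp
    show "((\<lambda>t. p (y s t)) has_real_derivative partial j p (y s t)) (at t)" if "\<bar>s\<bar> < \<delta>" "\<bar>t\<bar> < \<delta>" for s t
      by (rule dir_j[OF pd[OF yU[OF that]]])
    show "((\<lambda>s. r (y s t)) has_real_derivative partial i r (y s t)) (at s)" if "\<bar>s\<bar> < \<delta>" "\<bar>t\<bar> < \<delta>" for s t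
      by (rule dir_i[OF rd[OF yU[OF that]]])
  qed (rule cont[OF p], rule cont[OF r])
  then show ?thesis by (simp add: y_def)
qed

section \<open>Sums over the tetrahedra at a vertex\<close>

lemma tetrahedron_edge:
  assumes "simplicial_complex T" "tetrahedron T i j k l" "a \<in> {i, j, k, l}" "b \<in> {i, j, k, l}" "a \<noteq> b"
  shows "edge T a b"
proof -
  have "{i, j, k, l} \<in> T" "{a, b} \<noteq> {}" "{a, b} \<subseteq> {i, j, k, l}"
    using assms by (auto simp: tetrahedron_def)
  then have "{a, b} \<in> T"
    using assms(1) unfolding simplicial_complex_def by metis
  then show ?thesis
    using assms(5) by (simp add: edge_def)
qed

lemma tetrahedron_triangle:
  assumes "simplicial_complex T" "tetrahedron T i j k l"
    "a \<in> {i, j, k, l}" "b \<in> {i, j, k, l}" "c \<in> {i, j, k, l}" "distinct [a, b, c]"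
  shows "triangle T a b c"
proof -
  have "{i, j, k, l} \<in> T" "{a, b, c} \<noteq> {}" "{a, b, c} \<subseteq> {i, j, k, l}"
    using assms by (auto simp: tetrahedron_def)
  then have "{a, b, c} \<in> T"
    using assms(1) unfolding simplicial_complex_def by metis
  then show ?thesis
    using assms(6) by (simp add: triangle_def)
qed

lemma tetrahedron_rotate: "tetrahedron T i j k l \<Longrightarrow> tetrahedron T i k l j"
  by (auto simp: tetrahedron_def insert_commute)

lemma met_euclidean_tetra:
  "d \<in> met T \<Longrightarrow> tetrahedron T i j k l \<Longrightarrow> euclidean_tetra d i j k l"
  by (auto simp: met_def piecewise_flat_def tetrahedron_def euclidean_tetra_def)

lemma met_triangle:
  assumes "d \<in> met T" "triangle T i j k"
  shows "(d i j)\<^sup>2 + (d j k)\<^sup>2 + (d k i)\<^sup>2 = (d j i)\<^sup>2 + (d i k)\<^sup>2 + (d k j)\<^sup>2"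
  by (rule assms(1)[unfolded met_def mem_Collect_eq, THEN conjunct2, rule_format, OF assms(2)])

lemma tetra_sum_cong:
  "(\<And>k l. tetrahedron T i j k l \<Longrightarrow> F k l = H k l) \<Longrightarrow> tetra_sum T i j F = tetra_sum T i j H"
  unfolding tetra_sum_def by (auto intro!: sum.cong)

lemma tetra_sum_mult_right: "tetra_sum T i j F * c = tetra_sum T i j (\<lambda>k l. F k l * c)"
  by (simp add: tetra_sum_def sum_distrib_right case_prod_unfold mult.assoc)

lemma tetra_sum_has_derivative:
  assumes "\<And>k l. tetrahedron T i j k l \<Longrightarrow> ((\<lambda>s. F s k l) has_real_derivative F' k l) (at t)"
  shows "((\<lambda>s. tetra_sum T i j (F s)) has_real_derivative tetra_sum T i j F') (at t)"
  unfolding tetra_sum_def by (intro DERIV_cmult DERIV_sum) (use assms in auto)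

lemma sum_tetra_sum:
  assumes "simplicial_complex T"
  shows "(\<Sum>j | edge T i j. tetra_sum T i j (F j))
       = 1/2 * (\<Sum>(j, k, l) | tetrahedron T i j k l. F j k l)"
proof -
  have "(\<Sum>j | edge T i j. \<Sum>(k, l) | tetrahedron T i j k l. F j k l)
      = (\<Sum>(j, k, l) \<in> (SIGMA j:{j. edge T i j}. {(k, l). tetrahedron T i j k l}). F j k l)"
    by (subst sum.Sigma) auto
  also have "(SIGMA j:{j. edge T i j}. {(k, l). tetrahedron T i j k l}) = {(j, k, l). tetrahedron T i j k l}"
    using tetrahedron_edge[OF assms, of i _ _ _ i] by (auto simp: tetrahedron_def)
  finally show ?thesis
    unfolding tetra_sum_def sum_distrib_left[symmetric] by simp
qed

text \<open>
  Summing over the edges at \<open>i\<close> and then over the tetrahedra at each of them is summing over ordered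
  triples \<open>(j, k, l)\<close>. The rotation of \<open>j, k, l\<close> permutes these triples, so only the cyclic sums of the
  summands matter.
\<close>

lemma sum_tetra_sum_cyclic:
  assumes T: "simplicial_complex T"
    and cyc: "\<And>j k l. tetrahedron T i j k l \<Longrightarrow>
      F j k l + F k l j + F l j k = H j k l + H k l j + H l j k"
  shows "(\<Sum>j | edge T i j. tetra_sum T i j (F j)) = (\<Sum>j | edge T i j. tetra_sum T i j (H j))"
proof -
  let ?S = "{(j, k, l). tetrahedron T i j k l}"
  have rot: "(\<Sum>(j, k, l)\<in>?S. N k l j) = (\<Sum>(j, k, l)\<in>?S. N j k l)" for N :: "'a \<Rightarrow> 'a \<Rightarrow> 'a \<Rightarrow> real"
    by (rule sum.reindex_bij_witness[where i = "\<lambda>(j, k, l). (l, j, k)" and j = "\<lambda>(j, k, l). (k, l, j)"])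
       (auto dest: tetrahedron_rotate)
  have triple: "3 * (\<Sum>(j, k, l)\<in>?S. N j k l) = (\<Sum>(j, k, l)\<in>?S. N j k l + N k l j + N l j k)"
    for N :: "'a \<Rightarrow> 'a \<Rightarrow> 'a \<Rightarrow> real"
    using rot[of N] rot[of "\<lambda>j k l. N k l j"] by (simp add: sum.distrib case_prod_unfold)
  have "(\<Sum>(j, k, l)\<in>?S. F j k l + F k l j + F l j k) = (\<Sum>(j, k, l)\<in>?S. H j k l + H k l j + H l j k)"
    by (rule sum.cong) (auto simp: cyc)
  then have "3 * (\<Sum>(j, k, l)\<in>?S. F j k l) = 3 * (\<Sum>(j, k, l)\<in>?S. H j k l)"
    by (simp only: triple)
  then show ?thesis
    unfolding sum_tetra_sum[OF T] by simp
qed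

lemma realizes_cong:
  assumes "\<And>a b. a \<in> \<sigma> \<Longrightarrow> b \<in> \<sigma> \<Longrightarrow> a \<noteq> b \<Longrightarrow> d a b = e a b"
  shows "realizes (len d) \<sigma> = realizes (len e) \<sigma>"
proof (rule ext)
  fix p
  have "len d a b = len e a b" if "a \<in> \<sigma>" "b \<in> \<sigma>" "a \<noteq> b" for a b
    using assms[OF that] assms[OF that(2,1)] that(3) by (simp add: len_def)
  then show "realizes (len d) \<sigma> p = realizes (len e) \<sigma> p"
    unfolding realizes_def by (simp cong: ball_cong)
qed

text \<open>
  A metric and its extension to a conformal structure are only required to agree on directed edges, so
  the angles and dual areas have to be shown to depend on nothing else.
\<close>

lemma tetrahedron_quantities_cong:
  assumes "\<And>a b. a \<in> {i, j, k, l} \<Longrightarrow> b \<in> {i, j, k, l} \<Longrightarrow> a \<noteq> b \<Longrightarrow> d a b = e a b" and "distinct [i, j, k, l]"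
  shows "dihedral d i j k l = dihedral e i j k l" "dual_area d i j k l = dual_area e i j k l"
proof -
  have r: "realizes (len d) {i, j, k, l} = realizes (len e) {i, j, k, l}"
    "realizes (len d) {i, j, l, k} = realizes (len e) {i, j, l, k}"
    "realizes (len d) {i, j, k} = realizes (len e) {i, j, k}" "realizes (len d) {i, j, l} = realizes (len e) {i, j, l}"
    by (rule realizes_cong; use assms(1) in auto)+
  have ed: "d i j = e i j" "d i k = e i k" "d i l = e i l"
    using assms by auto
  show "dihedral d i j k l = dihedral e i j k l" "dual_area d i j k l = dual_area e i j k l"
    unfolding dual_area_def height3_def height2_def face_angle_def dihedral_def r ed by simp_all
qed

section \<open>Conformal structures and scalar curvature\<close>

lemma Ck_1_differentiable: "Ck_on 1 S g \<Longrightarrow> x \<in> S \<Longrightarrow> g differentiable (at x)"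
  by simp

lemma conformal_structureD:
  assumes "conformal_structure T U C" "edge T i j"
  shows "Ck_on 1 U (\<lambda>x. C x i j)"
    and "x \<in> U \<Longrightarrow> partial i (\<lambda>y. len (C y) i j) x = C x i j"
    and "x \<in> U \<Longrightarrow> k \<noteq> i \<Longrightarrow> k \<noteq> j \<Longrightarrow> partial k (\<lambda>y. C y i j) x = 0"
  using assms unfolding conformal_structure_def smooth_on_def by blast+

lemma edge_commute: "edge T i j \<Longrightarrow> edge T j i"
  by (auto simp: edge_def insert_commute)

lemma partial_len:
  assumes "(\<lambda>y. C y i j) differentiable (at x)" "(\<lambda>y. C y j i) differentiable (at x)"
  shows "(\<lambda>y. len (C y) i j) differentiable (at x)"
    and "partial k (\<lambda>y. len (C y) i j) x = partial k (\<lambda>y. C y i j) x + partial k (\<lambda>y. C y j i) x"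
proof -
  obtain A B where *: "((\<lambda>y. C y i j) has_derivative A) (at x)" "((\<lambda>y. C y j i) has_derivative B) (at x)"
    using assms by (auto simp: differentiable_def)
  then have "((\<lambda>y. len (C y) i j) has_derivative (\<lambda>h. A h + B h)) (at x)"
    unfolding len_def by (rule has_derivative_add)
  then show "(\<lambda>y. len (C y) i j) differentiable (at x)"
    "partial k (\<lambda>y. len (C y) i j) x = partial k (\<lambda>y. C y i j) x + partial k (\<lambda>y. C y j i) x"
    using partial_has_derivative(2)[OF *(1)] partial_has_derivative(2)[OF *(2)]
      partial_has_derivative(2)[of "\<lambda>y. len (C y) i j" "\<lambda>h. A h + B h"]
    by (auto simp: differentiable_def)
qed

lemma sum_two_support:
  fixes h :: "'v::finite \<Rightarrow> real"
  assumes "i \<noteq> j" "\<And>k. k \<noteq> i \<Longrightarrow> k \<noteq> j \<Longrightarrow> h k = 0"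
  shows "(\<Sum>k\<in>UNIV. h k) = h i + h j"
proof -
  have "(\<Sum>k\<in>UNIV. h k) = (\<Sum>k\<in>{i, j}. h k)"
    by (rule sum.mono_neutral_right) (use assms in auto)
  then show ?thesis using assms(1) by simp
qed

text \<open>
  Both sides are mixed second derivatives of \<open>\<ell>\<^bsub>ij\<^esub>\<close>, because \<open>d\<^bsub>ij\<^esub>\<close> and \<open>d\<^bsub>ji\<^esub>\<close> are its first partial
  derivatives.
\<close>

lemma conformal_mixed_partials:
  assumes C: "conformal_structure T U C" and e: "edge T i j" and x: "x \<in> U"
  shows "partial j (\<lambda>y. C y i j) x = partial i (\<lambda>y. C y j i) x"
proof -
  note c1 = conformal_structureD[OF C e] and c2 = conformal_structureD[OF C edge_commute[OF e]]
  show ?thesis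
  proof (rule mixed_partials_eq[where g = "\<lambda>y. len (C y) i j" and p = "\<lambda>y. C y i j" and r = "\<lambda>y. C y j i"])
    show "open U" using C by (simp add: conformal_structure_def)
    show "(\<lambda>y. len (C y) i j) differentiable (at y)" if "y \<in> U" for y
      using partial_len(1)[where C = C, OF Ck_1_differentiable[OF c1(1) that] Ck_1_differentiable[OF c2(1) that]] .
    show "partial j (\<lambda>y. len (C y) i j) y = C y j i" if "y \<in> U" for y
      using c2(2)[OF that] by (simp add: len_commute)
  qed (use x c1 c2 in auto)
qed

text \<open>
  Differentiating \<open>\<ell>\<^bsub>ij\<^esub> = d\<^bsub>ij\<^esub> + d\<^bsub>ji\<^esub>\<close> by \<open>f\<^sub>i\<close> gives \<open>d\<^bsub>ij\<^esub> = \<partial>d\<^bsub>ij\<^esub>/\<partial>f\<^sub>i + q\<^bsub>ij\<^esub>\<close>; this is where the second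
  equation gets the term \<open>d\<^bsub>ij\<^esub> f\<^sub>i'\<close>, which later sums to \<open>K\<^sub>i f\<^sub>i'\<close>.
\<close>

lemma conformal_derivatives:
  fixes f :: "real \<Rightarrow> real ^ 'v::finite"
  assumes C: "conformal_structure T U C" and e: "edge T i j" and x: "f t \<in> U" and f: "f differentiable (at t)"
  defines "f' \<equiv> \<lambda>k. deriv (\<lambda>s. f s $ k) t"
  shows "((\<lambda>s. len (C (f s)) i j) has_real_derivative C (f t) i j * f' i + C (f t) j i * f' j) (at t)"
    and "((\<lambda>s. C (f s) i j) has_real_derivative
           C (f t) i j * f' i + partial j (\<lambda>y. C y i j) (f t) * (f' j - f' i)) (at t)"
proof -
  note c1 = conformal_structureD[OF C e] and c2 = conformal_structureD[OF C edge_commute[OF e]]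
  have ne: "i \<noteq> j" using e by (simp add: edge_def)
  note D = Ck_1_differentiable[OF c1(1) x] Ck_1_differentiable[OF c2(1) x]
  note pl = partial_len[where C = C and i = i and j = j, OF D]
  have pi: "partial i (\<lambda>y. len (C y) i j) (f t) = C (f t) i j" using c1(2)[OF x] .
  have pj: "partial j (\<lambda>y. len (C y) i j) (f t) = C (f t) j i" using c2(2)[OF x] by (simp add: len_commute)
  show "((\<lambda>s. len (C (f s)) i j) has_real_derivative C (f t) i j * f' i + C (f t) j i * f' j) (at t)"
    using partial_chain_rule[OF pl(1) f]
    by (rule DERIV_cong, subst sum_two_support[OF ne])
       (simp_all only: pi pj f'_def, simp add: pl(2) c1(3)[OF x] c2(3)[OF x])
  have own: "partial i (\<lambda>y. C y i j) (f t) = C (f t) i j - partial j (\<lambda>y. C y i j) (f t)"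
    using pi pl(2)[of i] conformal_mixed_partials[OF C e x] by simp
  show "((\<lambda>s. C (f s) i j) has_real_derivative
           C (f t) i j * f' i + partial j (\<lambda>y. C y i j) (f t) * (f' j - f' i)) (at t)"
    using partial_chain_rule[OF D(1) f]
    by (rule DERIV_cong, subst sum_two_support[OF ne])
       (simp_all add: own c1(3)[OF x] f'_def algebra_simps)
qed

lemma conformal_structure_motion:
  fixes f :: "real \<Rightarrow> real ^ 'v::finite"
  assumes T: "simplicial_complex T" and C: "conformal_structure T U C"
    and x: "f t \<in> U" and f: "f differentiable (at t)" and tet: "tetrahedron T i j k l"
  shows "conformal_motion {i, j, k, l} (\<lambda>s. C (f s)) (\<lambda>k. deriv (\<lambda>s. f s $ k) t) t"
  unfolding conformal_motion_def
proof (intro conjI ballI impI)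
  fix a b assume "a \<in> {i, j, k, l}" "b \<in> {i, j, k, l}" "a \<noteq> b"
  then show "((\<lambda>s. len (C (f s)) a b) has_real_derivative
      C (f t) a b * deriv (\<lambda>s. f s $ a) t + C (f t) b a * deriv (\<lambda>s. f s $ b) t) (at t)"
    using conformal_derivatives(1)[OF C tetrahedron_edge[OF T tet] x f] by blast
next
  fix a b c assume abc: "a \<in> {i, j, k, l}" "b \<in> {i, j, k, l}" "c \<in> {i, j, k, l}" "distinct [a, b, c]"
  have "C (f t) \<in> met T" using C x by (simp add: conformal_structure_def)
  from met_triangle[OF this tetrahedron_triangle[OF T tet abc]]
  show "(C (f t) a b)\<^sup>2 + (C (f t) b c)\<^sup>2 + (C (f t) c a)\<^sup>2 = (C (f t) b a)\<^sup>2 + (C (f t) a c)\<^sup>2 + (C (f t) c b)\<^sup>2" .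
qed

text \<open>
  The product rule gives the second sum and \<open>- \<Sum>\<^sub>j (\<Sum> \<beta>') d\<^bsub>ij\<^esub>\<close>. The identity \<open>tetra_variation\<close>, applied
  to every tetrahedron at \<open>i\<close>, turns the latter into the sum of dual lengths.
\<close>

lemma scalar_curvature_variation:
  fixes f :: "real \<Rightarrow> real ^ 'v::finite" and i :: 'v and t :: real
  assumes T: "simplicial_complex T" and C: "conformal_structure T U C"
    and U: "\<forall>\<^sub>F s in nhds t. f s \<in> U" and f: "f differentiable (at t)"
  defines "f' \<equiv> \<lambda>k. deriv (\<lambda>s. f s $ k) t" and "d \<equiv> C (f t)"
  shows "((\<lambda>s. scalar_curvature T (C (f s)) i) has_real_derivative
        - 2 * (\<Sum>j | edge T i j. dual_length T d i j / len d i j * (f' j - f' i))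
        + (\<Sum>j | edge T i j. (2 * pi - tetra_sum T i j (\<lambda>k l. dihedral d i j k l))
                              * deriv (\<lambda>s. C (f s) i j) t)) (at t)"
proof -
  have x: "f t \<in> U" using eventually_nhds_x_imp_x[OF U] .
  let ?\<beta> = "\<lambda>j k l. deriv (\<lambda>s. dihedral (C (f s)) i j k l) t"
  have tet: "\<forall>\<^sub>F s in nhds t. euclidean_tetra (C (f s)) i j k l" if "tetrahedron T i j k l" for j k l
    using U by (rule eventually_mono) (use C that in \<open>auto simp: conformal_structure_def intro: met_euclidean_tetra\<close>)
  note motion = conformal_structure_motion[OF T C x f]
  have K: "((\<lambda>s. scalar_curvature T (C (f s)) i) has_real_derivative
      (\<Sum>j | edge T i j. (0 - tetra_sum T i j (?\<beta> j)) * d i j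
        + deriv (\<lambda>s. C (f s) i j) t * (2 * pi - tetra_sum T i j (dihedral d i j)))) (at t)"
    unfolding scalar_curvature_def d_def
  proof (intro DERIV_sum DERIV_mult DERIV_diff DERIV_const tetra_sum_has_derivative)
    fix j k l assume t: "tetrahedron T i j k l"
    show "((\<lambda>s. dihedral (C (f s)) i j k l) has_real_derivative ?\<beta> j k l) (at t)"
      by (rule dihedral_differentiable[OF tet[OF t] motion[OF t]])
  next
    fix j assume "j \<in> {j. edge T i j}"
    then have "edge T i j" by simp
    note der = conformal_derivatives(2)[OF C this x f]
    show "((\<lambda>s. C (f s) i j) has_real_derivative deriv (\<lambda>s. C (f s) i j) t) (at t)"
      unfolding DERIV_imp_deriv[OF der] by (rule der)
  qed
  have "(\<Sum>j | edge T i j. tetra_sum T i j (?\<beta> j) * d i j)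
      = (\<Sum>j | edge T i j. tetra_sum T i j (\<lambda>k l. ?\<beta> j k l * d i j))"
    by (simp only: tetra_sum_mult_right)
  also have "\<dots> = (\<Sum>j | edge T i j. tetra_sum T i j (\<lambda>k l. 2 * (dual_area d i j k l / len d i j * (f' j - f' i))))"
  proof (rule sum_tetra_sum_cyclic[OF T])
    fix j k l assume t: "tetrahedron T i j k l"
    show "?\<beta> j k l * d i j + ?\<beta> k l j * d i k + ?\<beta> l j k * d i l
      = 2 * (dual_area d i j k l / len d i j * (f' j - f' i)) + 2 * (dual_area d i k l j / len d i k * (f' k - f' i))
        + 2 * (dual_area d i l j k / len d i l * (f' l - f' i))"
      using tetra_variation[OF tet[OF t] motion[OF t]] by (simp only: d_def f'_def distrib_left)
  qed
  also have "\<dots> = 2 * (\<Sum>j | edge T i j. dual_length T d i j / len d i j * (f' j - f' i))"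
  proof -
    have "2 * (a / L * g) = a * (2 / L * g)" for a L g :: real by simp
    then show ?thesis
      unfolding dual_length_def sum_distrib_left by (simp only: tetra_sum_mult_right)
  qed
  finally have S: "(\<Sum>j | edge T i j. tetra_sum T i j (?\<beta> j) * d i j)
      = 2 * (\<Sum>j | edge T i j. dual_length T d i j / len d i j * (f' j - f' i))" .
  show ?thesis
  proof (rule DERIV_cong[OF K])
    have "(\<Sum>j | edge T i j. (0 - tetra_sum T i j (?\<beta> j)) * d i j
        + deriv (\<lambda>s. C (f s) i j) t * (2 * pi - tetra_sum T i j (dihedral d i j)))
      = (\<Sum>j | edge T i j. (2 * pi - tetra_sum T i j (dihedral d i j)) * deriv (\<lambda>s. C (f s) i j) t)
        - (\<Sum>j | edge T i j. tetra_sum T i j (?\<beta> j) * d i j)"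
      unfolding sum_subtractf[symmetric] by (rule sum.cong) (simp_all add: algebra_simps)
    then show "(\<Sum>j | edge T i j. (0 - tetra_sum T i j (?\<beta> j)) * d i j
        + deriv (\<lambda>s. C (f s) i j) t * (2 * pi - tetra_sum T i j (dihedral d i j)))
      = - 2 * (\<Sum>j | edge T i j. dual_length T d i j / len d i j * (f' j - f' i))
        + (\<Sum>j | edge T i j. (2 * pi - tetra_sum T i j (\<lambda>k l. dihedral d i j k l))
                              * deriv (\<lambda>s. C (f s) i j) t)"
      unfolding S by simp
  qed
qed

theorem theorem34:
  fixes M :: "'m topology" and T :: "'v::finite set set" and d :: "'v edge_fun"
    and \<epsilon> :: real and f :: "real \<Rightarrow> real ^ 'v"
    and U :: "(real ^ 'v) set" and C :: "real ^ 'v \<Rightarrow> 'v edge_fun" and i :: 'v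
  assumes "closed_manifold 3 M" and "triangulates T M"
    and "d \<in> met T"
    and "conformal_variation T d \<epsilon> f" and "extends_variation T d \<epsilon> f U C"
  shows "let q = (\<lambda>j. partial j (\<lambda>x. C x i j) (f 0));
             f' = (\<lambda>j. deriv (\<lambda>t. f t $ j) 0)
         in
      (\<forall>j. edge T i j \<longrightarrow> q j = partial i (\<lambda>x. C x j i) (f 0)) \<and>
      ((\<lambda>t. scalar_curvature T (C (f t)) i) has_real_derivative
        - 2 * (\<Sum>j | edge T i j. dual_length T d i j / len d i j * (f' j - f' i))
        + (\<Sum>j | edge T i j. (2 * pi - tetra_sum T i j (\<lambda>k l. dihedral d i j k l))
                              * deriv (\<lambda>t. C (f t) i j) 0)) (at 0) \<and>
      ((\<lambda>t. scalar_curvature T (C (f t)) i) has_real_derivative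
        - (\<Sum>j | edge T i j. (2 * (dual_length T d i j / len d i j)
                               - q j / len d i j * edge_curvature T d i j) * (f' j - f' i))
        + scalar_curvature T d i * f' i) (at 0)"
proof -
  define q where "q = (\<lambda>j. partial j (\<lambda>x. C x i j) (f 0))"
  define f' where "f' = (\<lambda>j. deriv (\<lambda>t. f t $ j) 0)"
  have T: "simplicial_complex T" using assms(2) by (simp add: triangulates_def)
  have C: "conformal_structure T U C" and fU: "f ` {-\<epsilon><..<\<epsilon>} \<subseteq> U"
    and agree: "\<And>i j. edge T i j \<Longrightarrow> C (f 0) i j = d i j"
    using assms(5) by (auto simp: extends_variation_def)
  have \<epsilon>: "0 < \<epsilon>" and "Ck_on 1 {-\<epsilon><..<\<epsilon>} f"
    using assms(4) unfolding conformal_variation_def smooth_on_def by blast+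
  then have f: "f differentiable (at 0)" by simp
  have U: "\<forall>\<^sub>F s in nhds 0. f s \<in> U"
    unfolding eventually_nhds using \<epsilon> fU by (intro exI[of _ "{-\<epsilon><..<\<epsilon>}"]) auto
  have x: "f 0 \<in> U" using eventually_nhds_x_imp_x[OF U] .
  have dih: "dihedral (C (f 0)) i j k l = dihedral d i j k l"
    and area: "dual_area (C (f 0)) i j k l = dual_area d i j k l" if "tetrahedron T i j k l" for j k l
  proof -
    have eq: "C (f 0) a b = d a b" if "a \<in> {i, j, k, l}" "b \<in> {i, j, k, l}" "a \<noteq> b" for a b
      by (rule agree[OF tetrahedron_edge[OF T \<open>tetrahedron T i j k l\<close> that]])
    have dist: "distinct [i, j, k, l]" using that by (simp add: tetrahedron_def)
    show "dihedral (C (f 0)) i j k l = dihedral d i j k l"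
      by (rule tetrahedron_quantities_cong(1)[OF _ dist]) (rule eq)
    show "dual_area (C (f 0)) i j k l = dual_area d i j k l"
      by (rule tetrahedron_quantities_cong(2)[OF _ dist]) (rule eq)
  qed
  have len: "len (C (f 0)) i j = len d i j" if "edge T i j" for j
    using agree that edge_commute[OF that] by (simp add: len_def)
  have dihs: "tetra_sum T i j (dihedral (C (f 0)) i j) = tetra_sum T i j (dihedral d i j)" for j
    by (rule tetra_sum_cong) (rule dih)
  have dual: "dual_length T (C (f 0)) i j = dual_length T d i j" for j
    unfolding dual_length_def by (rule tetra_sum_cong) (rule area)
  let ?\<kappa> = "\<lambda>j. 2 * pi - tetra_sum T i j (\<lambda>k l. dihedral d i j k l)"
  have lengths: "(\<Sum>j | edge T i j. dual_length T (C (f 0)) i j / len (C (f 0)) i j * (f' j - f' i))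
      = (\<Sum>j | edge T i j. dual_length T d i j / len d i j * (f' j - f' i))"
    by (rule sum.cong) (simp_all add: dual len)
  have V: "((\<lambda>t. scalar_curvature T (C (f t)) i) has_real_derivative
        - 2 * (\<Sum>j | edge T i j. dual_length T d i j / len d i j * (f' j - f' i))
        + (\<Sum>j | edge T i j. ?\<kappa> j * deriv (\<lambda>t. C (f t) i j) 0)) (at 0)"
    using scalar_curvature_variation[OF T C U f, of i]
      lengths by (simp only: f'_def dihs)
  have sym: "\<forall>j. edge T i j \<longrightarrow> q j = partial i (\<lambda>x. C x j i) (f 0)"
    using conformal_mixed_partials[OF C _ x] unfolding q_def by blast
  have summand: "?\<kappa> j * deriv (\<lambda>t. C (f t) i j) 0
      = q j / len d i j * edge_curvature T d i j * (f' j - f' i) + ?\<kappa> j * d i j * f' i" if e: "edge T i j" for j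
  proof -
    obtain p where "realizes (len d) {i, j} p"
      using assms(3) e by (auto simp: met_def piecewise_flat_def edge_def)
    then have "len d i j \<noteq> 0"
      using e by (auto simp: realizes_def edge_def)
    have rate: "deriv (\<lambda>t. C (f t) i j) 0 = d i j * f' i + q j * (f' j - f' i)"
      using conformal_derivatives(2)[OF C e x f] agree[OF e] by (simp add: DERIV_imp_deriv q_def f'_def)
    from \<open>len d i j \<noteq> 0\<close> show ?thesis
      unfolding rate by (simp add: edge_curvature_def algebra_simps)
  qed
  have W: "((\<lambda>t. scalar_curvature T (C (f t)) i) has_real_derivative
        - (\<Sum>j | edge T i j. (2 * (dual_length T d i j / len d i j)
                               - q j / len d i j * edge_curvature T d i j) * (f' j - f' i))
        + scalar_curvature T d i * f' i) (at 0)"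
  proof (rule DERIV_cong[OF V])
    have "(\<Sum>j | edge T i j. ?\<kappa> j * deriv (\<lambda>t. C (f t) i j) 0)
      = (\<Sum>j | edge T i j. q j / len d i j * edge_curvature T d i j * (f' j - f' i)) + scalar_curvature T d i * f' i"
      by (simp add: summand sum.distrib scalar_curvature_def sum_distrib_right)
    moreover have "(\<Sum>j | edge T i j. (2 * (dual_length T d i j / len d i j)
                               - q j / len d i j * edge_curvature T d i j) * (f' j - f' i))
      = 2 * (\<Sum>j | edge T i j. dual_length T d i j / len d i j * (f' j - f' i))
        - (\<Sum>j | edge T i j. q j / len d i j * edge_curvature T d i j * (f' j - f' i))"
      unfolding sum_distrib_left sum_subtractf[symmetric] by (rule sum.cong) (simp_all only: left_diff_distrib mult.assoc)
    ultimately show "- 2 * (\<Sum>j | edge T i j. dual_length T d i j / len d i j * (f' j - f' i))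
        + (\<Sum>j | edge T i j. ?\<kappa> j * deriv (\<lambda>t. C (f t) i j) 0)
      = - (\<Sum>j | edge T i j. (2 * (dual_length T d i j / len d i j)
                               - q j / len d i j * edge_curvature T d i j) * (f' j - f' i))
        + scalar_curvature T d i * f' i"
      by linarith
  qed
  show ?thesis
    unfolding Let_def
    by (rule conjI[OF sym[unfolded q_def] conjI[OF V[unfolded f'_def] W[unfolded q_def f'_def]]])
qed

end
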